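(* Let $k>0$. For $0\le r<1$ and $x,y\in[-\pi,\pi]$, the Poisson kernel $P_k(r,x,y)=\sum_{n\in\mathbb{Z}}\gamma_n^k\,r^{|n|+k}\,E_n^k(ix)\,E_n^k(-iy)$ is given by $$P_k(r,x,y)=\frac{k}{2\pi}(1-r^2)\,r^{k}\int_{-1}^{1}\frac{(1+u)(1-u^2)^{k-1}\,du}{\bigl(1-2r(\cos x\cos y+u\sin x\sin y)+r^2\bigr)^{k+1}}.$$
   Context: Fix $k>0$. The Cherednik operator of type $A_1$ is $T^k f(x)=f'(x)+2k\,\frac{f(x)-f(-x)}{1-e^{-2x}}-k f(x)$ for $f\in C^1(\mathbb{R})$. On $\mathbb{Z}$ define the partial order $j\triangleleft n$ iff either ($|j|<|n|$ and $|n|-|j|$ is a positive even integer) or ($|j|=|n|$ and $n<j$). Let $dm_k(x)=|\sin x|^{2k}dx$ on $[-\pi,\pi]$ and $(f,g)_k=\int_{-\pi}^{\pi}f(x)\overline{g(x)}\,dm_k(x)$. For $n\in\mathbb{Z}$, the non-symmetric Heckman–Opdam polynomial $E_n^k$ is the unique function of the form $E_n^k(z)=e^{nz}+\sum_{j\triangleleft n}c_{n,j}e^{jz}$ ($z\in\mathbb{C}$, finitely many $j$) such that $(E_n^k(i\cdot),e^{ij\cdot})_k=0$ for all $j\triangleleft n$. These satisfy $T^kE_n^k=n_kE_n^k$, where $n_k=n+k$ if $n>0$ and $n_k=n-k$ if $n\le 0$; also $E_0^k=1$, $E_1^k(x)=e^x$, the coefficients $c_{n,j}$ are real and nonnegative,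 and $\{x\mapsto E_n^k(ix)\}_{n\in\mathbb{Z}}$ is an orthogonal basis of $L^2([-\pi,\pi],dm_k)$. Write $\|E_n^k\|_{2,k}^2=\int_{-\pi}^{\pi}|E_n^k(ix)|^2dm_k(x)$ and $\gamma_n^k=\|E_n^k\|_{2,k}^{-2}$. *)

theory Defs
  imports "HOL-Analysis.Analysis"
begin

definition tri :: "int \<Rightarrow> int \<Rightarrow> bool" where
  "tri j n \<longleftrightarrow>
     (\<bar>j\<bar> < \<bar>n\<bar> \<and> even (\<bar>n\<bar> - \<bar>j\<bar>)) \<or> (\<bar>j\<bar> = \<bar>n\<bar> \<and> n < j)"

definition Eform :: "int \<Rightarrow> (int \<Rightarrow> complex) \<Rightarrow> complex \<Rightarrow> complex" where
  "Eform n c z = exp (of_int n * z) + (\<Sum>j\<in>{j. tri j n}. c j * exp (of_int j * z))"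

definition ip_k :: "real \<Rightarrow> (real \<Rightarrow> complex) \<Rightarrow> (real \<Rightarrow> complex) \<Rightarrow> complex" where
  "ip_k k f g = integral {-pi..pi} (\<lambda>x. f x * cnj (g x) * of_real (\<bar>sin x\<bar> powr (2 * k)))"

text \<open>Non-symmetric Heckman--Opdam polynomial E_n^k: the unique function of the above form
  orthogonal to all e^{ij.} with j \<triangleleft> n (coefficients outside {j. j \<triangleleft> n} normalised to 0).\<close>
definition HO_E :: "real \<Rightarrow> int \<Rightarrow> complex \<Rightarrow> complex" where
  "HO_E k n = Eform n (THE c. (\<forall>j. \<not> tri j n \<longrightarrow> c j = 0) \<and>
       (\<forall>j. tri j n \<longrightarrow>
          ip_k k (\<lambda>x. Eform n c (\<i> * of_real x)) (\<lambda>x. exp (\<i> * of_int j * of_real x)) = 0))"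

definition norm2_k :: "real \<Rightarrow> int \<Rightarrow> real" where
  "norm2_k k n = integral {-pi..pi} (\<lambda>x. (cmod (HO_E k n (\<i> * of_real x)))\<^sup>2 * \<bar>sin x\<bar> powr (2 * k))"

definition gamma_k :: "real \<Rightarrow> int \<Rightarrow> real" where
  "gamma_k k n = 1 / norm2_k k n"

end

theory Submission
  imports Defs
begin

text \<open>
  For \<open>m > 0\<close> the functions \<open>E\<^sub>m(\<i>x)\<close> and \<open>E\<^sub>-\<^sub>m(\<i>x)\<close> span the same plane as \<open>C\<^sub>m\<^sup>k(cos x)\<close> and
  \<open>sin x C\<^sub>m\<^sub>-\<^sub>1\<^sup>k\<^sup>+\<^sup>1(cos x)\<close>, where \<open>C\<close> are the Gegenbauer polynomials. Hence the terms \<open>\<plusminus>m\<close> of the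
  Poisson kernel add up to the reproducing kernel of that plane, which can be computed in the even/odd
  orthogonal basis. The product formula
  \<open>\<integral> (1 - u\<^sup>2)\<^sup>k\<^sup>-\<^sup>1 C\<^sub>m\<^sup>k(cos x cos y + u sin x sin y) du = c C\<^sub>m\<^sup>k(cos x) C\<^sub>m\<^sup>k(cos y) / C\<^sub>m\<^sup>k(1)\<close>,
  applied with \<open>k\<close> to the even part and, after an integration by parts in \<open>u\<close>, with \<open>k + 1\<close> to the odd part,
  turns it into \<open>(m + k)/(2\<pi>) \<integral> (1 + u) (1 - u\<^sup>2)\<^sup>k\<^sup>-\<^sup>1 C\<^sub>m\<^sup>k(cos x cos y + u sin x sin y) du\<close>. Summation over
  \<open>m\<close> under the integral uses
  \<open>\<Sum>\<^sub>m (m + k) C\<^sub>m\<^sup>k(t) r\<^sup>m = k (1 - r\<^sup>2) / (1 - 2rt + r\<^sup>2)\<^sup>k\<^sup>+\<^sup>1\<close>.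
\<close>

section \<open>Recurrences for Gegenbauer polynomials\<close>

text \<open>\<open>has_sum\<close> over the integers means unconditional convergence, while the
  product formula only controls the sum of the terms \<open>m\<close> and \<open>-m\<close>. Each
  half is therefore bounded separately: on the diagonal both terms are nonnegative, so each is at
  most the paired value, and the arithmetic-geometric mean inequality carries this bound to distinct
  \<open>x\<close> and \<open>y\<close>. \<open>HO_E\<close> is a definite description, so every use
  rests on uniqueness; the weight vanishes only where \<open>sin x = 0\<close>, which makes the
  inner product definite on trigonometric polynomials. The odd functions carry the parameter
  \<open>k + 1\<close> because a factor \<open>(sin x)^2\<close> turns the weight with exponent
  \<open>2 * k\<close> into the one with exponent \<open>2 * (k + 1)\<close>. The factor
  \<open>1 + u\<close> in the result records the splitting: \<open>1\<close> produces the even part,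
  \<open>u\<close> the odd part. Gegenbauer values at \<open>1\<close> and the masses
  \<open>jacobi_mass\<close> cancel between the product formula and the norms; the surviving
  \<open>2 * pi\<close> comes from the Beta integrals of both weights and the duplication formula of
  the Gamma function.\<close>

fun gegenbauer :: "real \<Rightarrow> nat \<Rightarrow> real \<Rightarrow> real" where
  "gegenbauer k 0 t = 1"
| "gegenbauer k (Suc 0) t = 2 * k * t"
| "gegenbauer k (Suc (Suc n)) t =
     (2 * (real n + 1 + k) * t * gegenbauer k (Suc n) t - (real n + 2 * k) * gegenbauer k n t) / (real n + 2)"

lemma gegenbauer_mult_arg:
  "2 * (real n + 1 + k) * t * gegenbauer k (Suc n) t =
     (real n + 2) * gegenbauer k (Suc (Suc n)) t + (real n + 2 * k) * gegenbauer k n t"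
  by (simp add: field_simps)

lemma gegenbauer_mult_arg':
  assumes "k > 0"
  shows "t * gegenbauer k (Suc n) t =
     ((real n + 2) * gegenbauer k (Suc (Suc n)) t + (real n + 2 * k) * gegenbauer k n t)
       / (2 * (real n + 1 + k))"
  using gegenbauer_mult_arg[of n k t] assms by (simp add: field_simps del: gegenbauer.simps)

text \<open>With F_k = (1 - 2tX + X^2)^(-k) one has k F_k + X F_k' = k (1 - X^2) F_(k+1); this is
  the coefficient of X^(n+2). It is the bridge between the parameters \<open>k\<close> and
  \<open>k + 1\<close>, used for the derivative, for \<open>gegenbauer_lower\<close> and for the
  Poisson series. The proof stays with the recurrence and inserts the induction hypotheses into
  it.\<close>

lemma gegenbauer_raise:
  assumes "k > 0"
  shows "(real n + 2 + k) * gegenbauer k (Suc (Suc n)) t =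
           k * (gegenbauer (k + 1) (Suc (Suc n)) t - gegenbauer (k + 1) n t)"
proof (induction n rule: less_induct)
  case (less n)
  consider "n = 0" | "n = 1" | m where "n = Suc (Suc m)"
    by (metis One_nat_def not0_implies_Suc)
  then show ?case
  proof cases
    case 1
    then show ?thesis by (simp add: field_simps)
  next
    case 2
    then show ?thesis by (simp add: field_simps)
  next
    case 3
    define c where "c j = gegenbauer k j t" for j
    define q where "q j = gegenbauer (k+1) j t" for j
    have n: "real n = real m + 2" using 3 by simp
    have h1: "(real m + 3 + k) * c (Suc (Suc (Suc m))) = k * (q (Suc (Suc (Suc m))) - q (Suc m))"
      using less[of "Suc m"] 3 by (simp add: c_def q_def del: gegenbauer.simps) (simp add: add_ac del: gegenbauer.simps)
    have h0: "(real m + 2 + k) * c (Suc (Suc m)) = k * (q (Suc (Suc m)) - q m)"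
      using less[of m] 3 by (simp add: c_def q_def del: gegenbauer.simps)
    have rc: "(real m + 4) * c (Suc (Suc n)) = 2 * t * ((real m + 3 + k) * c (Suc n)) - (real m + 2 + 2 * k) * c n"
      using gegenbauer_mult_arg[of n k t] n by (simp add: c_def algebra_simps del: gegenbauer.simps)
    have rq1: "t * q (Suc n) = ((real m + 4) * q (Suc (Suc n)) + (real m + 2 * k + 4) * q n) / (2 * (real m + 4 + k))"
      using gegenbauer_mult_arg'[of "k+1" t n] assms n by (simp add: q_def add_ac del: gegenbauer.simps)
    have rq0: "t * q (Suc m) = ((real m + 2) * q n + (real m + 2 * k + 2) * q m) / (2 * (real m + 2 + k))"
      using gegenbauer_mult_arg'[of "k+1" t m] assms 3 by (simp add: q_def add_ac del: gegenbauer.simps)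
    have cn: "c n = k * (q n - q m) / (real m + 2 + k)"
      using h0 3 assms by (simp add: field_simps)
    have "(real m + 4) * c (Suc (Suc n)) = 2 * k * (t * q (Suc n) - t * q (Suc m)) - (real m + 2 + 2 * k) * c n"
      using rc h1 unfolding 3 by algebra
    also have "\<dots> = k * (real m + 4) * (q (Suc (Suc n)) - q n) / (real m + 4 + k)"
    proof -
      have p: "real m + 2 + k > 0" "real m + 4 + k > 0" using assms by auto
      define M where "M = real m + 2 + k"
      have e: "real m = M - 2 - k" by (simp add: M_def)
      show ?thesis
        unfolding rq1 rq0 cn using p unfolding e by (simp add: divide_simps) algebra
    qed
    finally have "c (Suc (Suc n)) = k * (q (Suc (Suc n)) - q n) / (real m + 4 + k)"
      using assms by (simp add: divide_simps split: if_splits)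
    then show ?thesis using n assms by (simp add: c_def q_def add_ac del: gegenbauer.simps)
  qed
qed

lemma gegenbauer_has_derivative:
  assumes "k > 0"
  shows "(gegenbauer k (Suc n) has_real_derivative 2 * k * gegenbauer (k + 1) n t) (at t within S)"
proof (induction n rule: less_induct)
  case (less n)
  have e: "gegenbauer k (Suc 0) = (\<lambda>t. 2 * k * t)"
    by (rule ext) simp
  show ?case
  proof (cases n)
    case 0
    then show ?thesis unfolding 0 e by (auto intro!: derivative_eq_intros)
  next
    case (Suc m)
    have eq: "gegenbauer k (Suc (Suc m)) = (\<lambda>t. (2 * (real m + 1 + k) * t * gegenbauer k (Suc m) t
        - (real m + 2 * k) * gegenbauer k m t) / (real m + 2))"
      by (rule ext) simp
    \<comment> \<open>\<open>d\<close> is the derivative of \<open>gegenbauer k m\<close>. The case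
      \<open>m = 0\<close> is separate because \<open>m - 1\<close> truncates to \<open>0\<close>,
      where the general formula would give \<open>2 * k\<close>.\<close>
    define d where "d = (if m = 0 then 0 else 2 * k * gegenbauer (k+1) (m - 1) t)"
    have d1: "(gegenbauer k (Suc m) has_real_derivative 2 * k * gegenbauer (k+1) m t) (at t within S)"
      using less[of m] Suc by simp
    have d0: "(gegenbauer k m has_real_derivative d) (at t within S)"
    proof (cases m)
      case 0
      have "gegenbauer k 0 = (\<lambda>t. 1)" by (rule ext) simp
      then show ?thesis using 0 by (simp add: d_def)
    next
      case (Suc j)
      then show ?thesis using less[of j] \<open>n = Suc m\<close> by (simp add: d_def del: gegenbauer.simps)
    qed
    have "(gegenbauer k (Suc (Suc m)) has_real_derivative
        (2 * (real m + 1 + k) * (gegenbauer k (Suc m) t + t * (2 * k * gegenbauer (k+1) m t)) - (real m + 2 * k) * d)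
          / (real m + 2)) (at t within S)"
      unfolding eq
      by (intro DERIV_cdivide DERIV_diff)
         (rule derivative_eq_intros d0 d1 refl | simp add: algebra_simps del: gegenbauer.simps)+
    moreover have "(2 * (real m + 1 + k) * (gegenbauer k (Suc m) t + t * (2 * k * gegenbauer (k+1) m t)) - (real m + 2 * k) * d)
          / (real m + 2) = 2 * k * gegenbauer (k + 1) (Suc m) t"
    proof (cases m)
      case 0
      then show ?thesis by (simp add: d_def algebra_simps)
    next
      case (Suc j)
      \<comment> \<open>The product rule leaves an undifferentiated term at parameter
        \<open>k\<close>; \<open>a\<close> moves it to parameter \<open>k + 1\<close>, where the
        recurrence \<open>b\<close> closes the identity.\<close>
      have a: "(real j + 2 + k) * gegenbauer k (Suc (Suc j)) t = k * (gegenbauer (k+1) (Suc (Suc j)) t - gegenbauer (k+1) j t)"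
        by (rule gegenbauer_raise[OF assms])
      have b: "2 * (real j + 2 + k) * t * gegenbauer (k+1) (Suc j) t =
          (real j + 2) * gegenbauer (k+1) (Suc (Suc j)) t + (real j + 2 * k + 2) * gegenbauer (k+1) j t"
        using gegenbauer_mult_arg[of j "k+1" t] by (simp add: add_ac del: gegenbauer.simps)
      have d: "d = 2 * k * gegenbauer (k+1) j t" by (simp add: d_def Suc)
      have m: "real m = real j + 1" "m = Suc j" using Suc by auto
      have "2 * (real j + 2 + k) * (gegenbauer k (Suc m) t + t * (2 * k * gegenbauer (k+1) m t)) - (real j + 1 + 2 * k) * d
         = 2 * k * gegenbauer (k + 1) (Suc m) t * (real j + 3)"
        unfolding d unfolding m(2) using a b by algebra
      then show ?thesis unfolding m(1)
        by (simp add: divide_simps add_ac del: gegenbauer.simps)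
    qed
    ultimately show ?thesis using Suc by (simp del: gegenbauer.simps)
  qed
qed

text \<open>By \<open>gegenbauer_has_derivative\<close> the left side is a multiple of
  \<open>1 - t^2\<close> times the derivative of \<open>gegenbauer k (Suc n)\<close>, so this is the
  ladder relation for the derivative. From \<open>n = 2\<close> on, the right side is moved to
  parameter \<open>k + 1\<close> and \<open>t^2\<close> is expanded by using the recurrence
  twice.\<close>

lemma gegenbauer_lower:
  assumes "k > 0"
  shows "4 * k * (real n + 1 + k) * (1 - t\<^sup>2) * gegenbauer (k + 1) n t =
     (real n + 2 * k) * (real n + 1 + 2 * k) * gegenbauer k n t - (real n + 1) * (real n + 2) * gegenbauer k (Suc (Suc n)) t"
proof -
  consider "n = 0" | "n = 1" | m where "n = Suc (Suc m)"
    by (metis One_nat_def not0_implies_Suc)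
  then show ?thesis
  proof cases
    case 1
    then show ?thesis by (simp add: field_simps power2_eq_square)
  next
    case 2
    then show ?thesis by (simp add: field_simps power2_eq_square)
  next
    case 3
    define c where "c j = gegenbauer k j t" for j
    define q where "q j = gegenbauer (k+1) j t" for j
    define M where "M = real m + 2 + k"
    have n: "real n = M - k" "real m = M - k - 2" using 3 by (simp_all add: M_def)
    have M: "M > 2" using assms by (simp add: M_def)
    have c2: "c (Suc (Suc n)) = k * (q (Suc (Suc n)) - q n) / (M + 2)"
      using gegenbauer_raise[OF assms, of n t] n M by (simp add: c_def q_def field_simps del: gegenbauer.simps)
    have c0: "c n = k * (q n - q m) / M"
      using gegenbauer_raise[OF assms, of m t] n 3 M by (simp add: c_def q_def field_simps del: gegenbauer.simps)
    have t2: "t * q (Suc n) = ((M - k + 2) * q (Suc (Suc n)) + (M + k + 2) * q n) / (2 * (M + 2))"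
      using gegenbauer_mult_arg'[of "k+1" t n] n assms by (simp add: q_def algebra_simps del: gegenbauer.simps)
    have t1: "t * q n = ((M - k + 1) * q (Suc n) + (M + k + 1) * q (Suc m)) / (2 * (M + 1))"
      using gegenbauer_mult_arg'[of "k+1" t "Suc m"] n assms 3 by (simp add: q_def algebra_simps del: gegenbauer.simps)
    have t0: "t * q (Suc m) = ((M - k) * q n + (M + k) * q m) / (2 * M)"
      using gegenbauer_mult_arg'[of "k+1" t m] n assms 3 by (simp add: q_def algebra_simps del: gegenbauer.simps)
    have tt: "t\<^sup>2 * q n = ((M - k + 1) * (t * q (Suc n)) + (M + k + 1) * (t * q (Suc m))) / (2 * (M + 1))"
      using t1 by (simp add: power2_eq_square algebra_simps add_divide_distrib)
    have "4 * k * (M + 1) * (1 - t\<^sup>2) * q n = 4 * k * (M + 1) * (q n - t\<^sup>2 * q n)"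
      by (simp add: algebra_simps)
    also have "\<dots> = (M + k) * (M + k + 1) * c n - (M - k + 1) * (M - k + 2) * c (Suc (Suc n))"
      unfolding tt t2 t0 c2 c0 using M by (simp add: divide_simps) algebra
    finally show ?thesis unfolding n(1) c_def q_def by (simp add: algebra_simps del: gegenbauer.simps)
  qed
qed

section \<open>Values at the endpoint 1\<close>

lemma gegenbauer_one_Suc:
  "(real n + 1) * gegenbauer k (Suc n) 1 = (real n + 2 * k) * gegenbauer k n 1"
proof (induction n)
  case (Suc n)
  have "(real n + 2) * gegenbauer k (Suc (Suc n)) 1 =
      2 * (real n + 1 + k) * gegenbauer k (Suc n) 1 - (real n + 2 * k) * gegenbauer k n 1"
    using gegenbauer_mult_arg[of n k 1] by (simp del: gegenbauer.simps)
  with Suc show ?case by (simp add: algebra_simps del: gegenbauer.simps)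
qed simp

lemma gegenbauer_one_pos:
  assumes "k > 0"
  shows "gegenbauer k n 1 > 0"
proof (induction n)
  case (Suc n)
  have "(real n + 1) * gegenbauer k (Suc n) 1 > 0"
    unfolding gegenbauer_one_Suc using Suc assms by (simp add: add_nonneg_pos)
  then show ?case by (simp add: zero_less_mult_iff del: gegenbauer.simps)
qed simp

text \<open>Compares the normalisations at \<open>k\<close> and \<open>k + 1\<close>, which meet in
  the inductive step of the product formula.\<close>

lemma gegenbauer_one_raise:
  "2 * k * (2 * k + 1) * gegenbauer (k + 1) n 1 = (real n + 1) * (real n + 1 + 2 * k) * gegenbauer k (Suc n) 1"
proof (induction n)
  case (Suc n)
  define g where "g = gegenbauer k (Suc n) 1"
  define g' where "g' = gegenbauer k (Suc (Suc n)) 1"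
  define q where "q = gegenbauer (k + 1) n 1"
  define q' where "q' = gegenbauer (k + 1) (Suc n) 1"
  have 1: "(real n + 1) * q' = (real n + 2 * k + 2) * q"
    using gegenbauer_one_Suc[of n "k+1"] by (simp add: q_def q'_def algebra_simps del: gegenbauer.simps)
  have 2: "(real n + 2) * g' = (real n + 1 + 2 * k) * g"
    using gegenbauer_one_Suc[of "Suc n" k] by (simp add: g_def g'_def algebra_simps del: gegenbauer.simps)
  have 3: "2 * k * (2 * k + 1) * q = (real n + 1) * (real n + 1 + 2 * k) * g"
    using Suc by (simp add: g_def q_def)
  have "(real n + 1) * (2 * k * (2 * k + 1) * q') = (real n + 1) * ((real n + 2) * (real n + 2 + 2 * k) * g')"
    using 1 2 3 by algebra
  then have "2 * k * (2 * k + 1) * q' = (real n + 2) * (real n + 2 + 2 * k) * g'" 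
    by simp
  then show ?case by (simp add: g'_def q'_def algebra_simps del: gegenbauer.simps)
qed simp

declare gegenbauer.simps(3) [simp del]

section \<open>Generating functions\<close>

text \<open>
  The recurrence is the differential equation \<open>(1 - 2tX + X\<^sup>2) F' = 2k (t - X) F\<close> of the formal generating
  series, which is solved by \<open>(1 - zX)\<^sup>-\<^sup>k (1 - wX)\<^sup>-\<^sup>k\<close> if \<open>z w = 1\<close> and \<open>z + w = 2t\<close>.
\<close>

lemma gegenbauer_explicit:
  fixes \<theta> :: real
  shows "complex_of_real (gegenbauer k n (cos \<theta>)) =
     (\<Sum>j\<le>n. of_real (pochhammer k j / fact j * (pochhammer k (n - j) / fact (n - j))) * cis ((real n - 2 * real j) * \<theta>))"
proof -
  define a where "a j = complex_of_real (pochhammer k j / fact j)" for j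
  have a_Suc: "of_nat (Suc j) * a (Suc j) = (of_nat j + of_real k) * a j" for j
  proof -
    have "real (Suc j) * (pochhammer k (Suc j) / fact (Suc j)) = (real j + k) * (pochhammer k j / fact j)"
      by (simp add: pochhammer_Suc divide_simps del: of_nat_Suc)
    then have "complex_of_real (real (Suc j) * (pochhammer k (Suc j) / fact (Suc j)))
        = of_real ((real j + k) * (pochhammer k j / fact j))"
      by (simp only:)
    then show ?thesis unfolding a_def by (simp only: of_real_mult of_real_add of_real_of_nat_eq)
  qed
  define A where "A z = Abs_fps (\<lambda>j. a j * z ^ j)" for z :: complex
  have A_deriv: "(1 - fps_const z * fps_X) * fps_deriv (A z) = fps_const (of_real k * z) * A z" for z
  proof (rule fps_ext)
    fix n
    show "fps_nth ((1 - fps_const z * fps_X) * fps_deriv (A z)) n = fps_nth (fps_const (of_real k * z) * A z) n"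
    proof (cases n)
      case 0
      then show ?thesis using a_Suc[of 0] by (simp add: A_def)
    next
      case (Suc m)
      have "fps_nth ((1 - fps_const z * fps_X) * fps_deriv (A z)) n =
          (of_nat (Suc n) * a (Suc n) - of_nat n * a n) * (z * z ^ n)"
        using Suc by (simp add: A_def algebra_simps)
      then show ?thesis unfolding a_Suc by (simp add: A_def algebra_simps)
    qed
  qed
  define z where "z = cis \<theta>"
  define w where "w = cis (- \<theta>)"
  have zw: "z * w = 1" by (simp add: z_def w_def cis_mult)
  have zpw: "z + w = of_real (2 * cos \<theta>)" by (simp add: z_def w_def complex_eq_iff)
  define F where "F = A z * A w"
  have "(1 - fps_const z * fps_X) * (1 - fps_const w * fps_X) * fps_deriv F =
     ((1 - fps_const z * fps_X) * fps_deriv (A z)) * (1 - fps_const w * fps_X) * A w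
     + ((1 - fps_const w * fps_X) * fps_deriv (A w)) * (1 - fps_const z * fps_X) * A z"
    unfolding F_def fps_deriv_mult by algebra
  also have "\<dots> = (fps_const (of_real k * z) * (1 - fps_const w * fps_X) + fps_const (of_real k * w) * (1 - fps_const z * fps_X)) * F"
    unfolding A_deriv F_def by algebra
  also have "fps_const (of_real k * z) * (1 - fps_const w * fps_X) + fps_const (of_real k * w) * (1 - fps_const z * fps_X)
      = fps_const (of_real k * (z + w)) - fps_const (2 * of_real k * (z * w)) * fps_X"
    by (rule fps_ext) (auto simp: algebra_simps fps_numeral_nth)
  also have "(1 - fps_const z * fps_X) * (1 - fps_const w * fps_X) = 1 - fps_const (z + w) * fps_X + fps_const (z * w) * fps_X ^ 2"
    by (simp add: algebra_simps power2_eq_square flip: fps_const_add fps_const_mult)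
  finally have ode: "(1 - fps_const (z + w) * fps_X + fps_X ^ 2) * fps_deriv F =
     (fps_const (of_real k * (z + w)) - fps_const (2 * of_real k) * fps_X) * F"
    by (simp add: zw)
  then have ode': "fps_deriv F - fps_const (z + w) * (fps_X * fps_deriv F) + fps_X * (fps_X * fps_deriv F) =
     fps_const (of_real k * (z + w)) * F - fps_const (2 * of_real k) * (fps_X * F)"
    by algebra
  have F0: "fps_nth F 0 = 1" by (simp add: F_def A_def a_def)
  have F1: "fps_nth F (Suc 0) = of_real k * (z + w)"
    using arg_cong[OF ode', of "\<lambda>f. fps_nth f 0"] F0 by simp
  have F2: "(of_nat n + 2) * fps_nth F (Suc (Suc n)) =
      (of_nat n + 1 + of_real k) * (z + w) * fps_nth F (Suc n) - (of_nat n + 2 * of_real k) * fps_nth F n" for n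
    using arg_cong[OF ode', of "\<lambda>f. fps_nth f (Suc n)",
      unfolded fps_sub_nth fps_add_nth fps_mult_left_const_nth fps_X_mult_nth fps_deriv_nth]
    by (cases n) (simp_all add: algebra_simps F0)
  have F: "fps_nth F n = complex_of_real (gegenbauer k n (cos \<theta>))" for n
  proof (induction n rule: less_induct)
    case (less n)
    consider "n = 0" | "n = 1" | m where "n = Suc (Suc m)"
      by (metis One_nat_def not0_implies_Suc)
    then show ?case
    proof cases
      case 3
      have "(of_nat m + 2) * fps_nth F n = (of_nat m + 1 + of_real k) * of_real (2 * cos \<theta>) * of_real (gegenbauer k (Suc m) (cos \<theta>))
         - (of_nat m + 2 * of_real k) * of_real (gegenbauer k m (cos \<theta>))"
        using F2[of m] less[of m] less[of "Suc m"] 3 zpw by simp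
      also have "\<dots> = of_real ((real m + 2) * gegenbauer k n (cos \<theta>))"
        unfolding 3 gegenbauer.simps(3) by simp
      finally have "complex_of_real (real m + 2) * fps_nth F n = complex_of_real (real m + 2) * of_real (gegenbauer k n (cos \<theta>))"
        by simp
      moreover have "complex_of_real (real m + 2) \<noteq> 0" by (simp del: of_real_add)
      ultimately show ?thesis by (metis mult_left_cancel)
    qed (simp_all add: F0 F1 zpw)
  qed
  have "fps_nth F n = (\<Sum>j\<le>n. a j * z ^ j * (a (n - j) * w ^ (n - j)))"
    by (simp add: F_def A_def fps_mult_nth atLeast0AtMost)
  \<comment> \<open>Reversing the index gives \<open>z\<close> the power \<open>n - j\<close> and
    \<open>w\<close> the power \<open>j\<close>, hence the frequency \<open>n - 2 j\<close>.\<close>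
  also have "\<dots> = (\<Sum>j\<le>n. a (n - j) * z ^ (n - j) * (a j * w ^ j))"
    by (rule sum.reindex_bij_witness[of _ "\<lambda>j. n - j" "\<lambda>j. n - j"]) auto
  also have "\<dots> = (\<Sum>j\<le>n. a j * a (n - j) * cis ((real n - 2 * real j) * \<theta>))"
  proof (rule sum.cong)
    fix j assume "j \<in> {..n}"
    then have "z ^ (n - j) * w ^ j = cis ((real n - 2 * real j) * \<theta>)"
      by (simp add: z_def w_def Complex.DeMoivre cis_mult algebra_simps of_nat_diff)
    then show "a (n - j) * z ^ (n - j) * (a j * w ^ j) = a j * a (n - j) * cis ((real n - 2 * real j) * \<theta>)"
      by (metis (no_types, opaque_lifting) mult.assoc mult.commute)
  qed simp
  finally show ?thesis unfolding F a_def by simp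
qed

text \<open>For \<open>k > 0\<close> all Fourier coefficients in \<open>gegenbauer_explicit\<close>
  are nonnegative, so the triangle inequality gives exactly the value at angle 0. This supplies the
  dominating series for summation under the integral.\<close>

lemma gegenbauer_abs_le:
  assumes "k > 0" "\<bar>t\<bar> \<le> 1"
  shows "\<bar>gegenbauer k n t\<bar> \<le> gegenbauer k n 1"
proof -
  define \<theta> where "\<theta> = arccos t"
  have t: "cos \<theta> = t" using assms(2) by (simp add: \<theta>_def cos_arccos abs_le_iff)
  have "\<bar>gegenbauer k n t\<bar> = norm (complex_of_real (gegenbauer k n (cos \<theta>)))" by (simp add: t)
  also have "\<dots> \<le> (\<Sum>j\<le>n. pochhammer k j / fact j * (pochhammer k (n - j) / fact (n - j)))"
    unfolding gegenbauer_explicit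
    by (rule sum_norm_le) (use assms(1) in \<open>simp add: norm_mult norm_divide pochhammer_nonneg\<close>)
  also have "\<dots> = gegenbauer k n 1"
  proof -
    have "complex_of_real (gegenbauer k n 1) = of_real (\<Sum>j\<le>n. pochhammer k j / fact j * (pochhammer k (n - j) / fact (n - j)))"
      using gegenbauer_explicit[of k n 0] by simp
    then show ?thesis by (simp only: of_real_eq_iff)
  qed
  finally show ?thesis .
qed

text \<open>The Cauchy product of the binomial series at \<open>r * cis \<theta>\<close> and at its
  conjugate has the terms of \<open>gegenbauer_explicit\<close>, and its value is
  \<open>norm (1 - r * cis \<theta>)\<close> to the power -2k.\<close>

lemma sums_gegenbauer:
  assumes "k > 0" "\<bar>t\<bar> \<le> 1" "0 \<le> r" "r < 1"
  shows "(\<lambda>n. gegenbauer k n t * r ^ n) sums ((1 - 2 * r * t + r\<^sup>2) powr (- k))"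
proof -
  define \<theta> where "\<theta> = arccos t"
  have t: "cos \<theta> = t" using assms(2) by (simp add: \<theta>_def cos_arccos abs_le_iff)
  define a where "a j = complex_of_real (pochhammer k j / fact j)" for j
  have a: "a j = (- of_real k gchoose j) * (-1) ^ j" for j
    unfolding a_def by (simp add: gbinomial_pochhammer pochhammer_of_real[symmetric])
  define z where "z \<phi> = of_real r * cis \<phi>" for \<phi>
  have nz: "norm (z \<phi>) = r" for \<phi> using assms by (simp add: z_def norm_mult)
  have S: "(\<lambda>j. a j * z \<phi> ^ j) sums ((1 - z \<phi>) powr (- of_real k))" for \<phi>
    using gen_binomial_complex[of "- z \<phi>" "- of_real k"] nz[of \<phi>] assms
    by (simp add: a power_minus[of "z \<phi>"] mult.assoc)
  have An: "summable (\<lambda>j. norm (a j * z \<phi> ^ j))" for \<phi>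
  proof -
    have "(\<lambda>j. a j * of_real r ^ j) sums ((1 - of_real r) powr (- of_real k))"
      using S[of 0] by (simp add: z_def)
    then have "summable (\<lambda>j. a j * of_real r ^ j)" by (rule sums_summable)
    then have "summable (\<lambda>j. complex_of_real (pochhammer k j / fact j * r ^ j))" by (simp add: a_def)
    then have "summable (\<lambda>j. pochhammer k j / fact j * r ^ j)" by (rule summable_of_real_iff[THEN iffD1])
    moreover have "norm (a j * z \<phi> ^ j) = pochhammer k j / fact j * r ^ j" for j
      using assms by (simp add: norm_mult norm_power nz a_def norm_divide pochhammer_nonneg)
    ultimately show ?thesis by simp
  qed
  have "(\<lambda>n. \<Sum>j\<le>n. (a j * z (-\<theta>) ^ j) * (a (n - j) * z \<theta> ^ (n - j))) sums
      ((\<Sum>j. a j * z (-\<theta>) ^ j) * (\<Sum>j. a j * z \<theta> ^ j))"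
    by (rule Cauchy_product_sums[OF An An])
  moreover have "(\<Sum>j\<le>n. (a j * z (-\<theta>) ^ j) * (a (n - j) * z \<theta> ^ (n - j))) = of_real (gegenbauer k n t * r ^ n)" for n
  proof -
    have "(a j * z (-\<theta>) ^ j) * (a (n - j) * z \<theta> ^ (n - j)) =
       a j * a (n - j) * cis ((real n - 2 * real j) * \<theta>) * of_real r ^ n" if "j \<le> n" for j
    proof -
      have 1: "cis (-\<theta>) ^ j * cis \<theta> ^ (n - j) = cis ((real n - 2 * real j) * \<theta>)"
        using that by (simp add: Complex.DeMoivre cis_mult algebra_simps of_nat_diff)
      have 2: "complex_of_real r ^ j * of_real r ^ (n - j) = of_real r ^ n"
        using that by (simp flip: power_add)
      show ?thesis
        unfolding z_def power_mult_distrib 1[symmetric] 2[symmetric] by (simp add: mult_ac)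
    qed
    then have "(\<Sum>j\<le>n. (a j * z (-\<theta>) ^ j) * (a (n - j) * z \<theta> ^ (n - j))) =
        (\<Sum>j\<le>n. a j * a (n - j) * cis ((real n - 2 * real j) * \<theta>)) * of_real r ^ n"
      unfolding sum_distrib_right by (intro sum.cong) auto
    then show ?thesis
      using gegenbauer_explicit[of k n \<theta>] by (simp add: t a_def)
  qed
  moreover have "(\<Sum>j. a j * z (-\<theta>) ^ j) * (\<Sum>j. a j * z \<theta> ^ j) = of_real ((1 - 2 * r * t + r\<^sup>2) powr (- k))"
  proof -
    define Z where "Z = 1 - z \<theta>"
    \<comment> \<open>A positive real part keeps \<open>Z\<close> off the branch cut, so conjugation
      commutes with \<open>powr\<close>.\<close>
    have Re: "Re Z > 0"
    proof -
      have "r * cos \<theta> \<le> r" using assms(3) mult_left_mono[of "cos \<theta>" 1 r] by simp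
      then show ?thesis using assms by (simp add: Z_def z_def)
    qed
    have "1 - z (-\<theta>) = cnj Z" by (simp add: Z_def z_def cis_cnj)
    have "(\<Sum>j. a j * z (-\<theta>) ^ j) * (\<Sum>j. a j * z \<theta> ^ j) = (cnj Z) powr (- of_real k) * Z powr (- of_real k)"
      using sums_unique[OF S[of \<theta>]] sums_unique[OF S[of "-\<theta>"]] \<open>1 - z (-\<theta>) = cnj Z\<close> by (simp add: Z_def)
    also have "\<dots> = cnj (Z powr (- of_real k)) * Z powr (- of_real k)"
      using Re cnj_powr[of Z "- of_real k"] by simp
    also have "\<dots> = of_real ((norm (Z powr (- of_real k)))\<^sup>2)"
      unfolding complex_norm_square by (rule mult.commute)
    also have "norm (Z powr (- of_real k)) = norm Z powr (- k)"
      using norm_powr_real_powr'[of "- of_real k" Z] by simp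
    also have "(norm Z powr (- k))\<^sup>2 = (norm Z ^ 2) powr (- k)"
      by (simp add: power2_eq_square powr_mult)
    also have "norm Z ^ 2 = 1 - 2 * r * t + r\<^sup>2"
    proof -
      have "norm Z ^ 2 = (1 - r * cos \<theta>)\<^sup>2 + (r * sin \<theta>)\<^sup>2"
        unfolding cmod_power2 by (simp add: Z_def z_def)
      also have "\<dots> = 1 - 2 * r * cos \<theta> + r\<^sup>2 * ((sin \<theta>)\<^sup>2 + (cos \<theta>)\<^sup>2)"
        by algebra
      finally show ?thesis by (simp only: sin_cos_squared_add) (simp add: t)
    qed
    finally show ?thesis .
  qed
  ultimately have "(\<lambda>n. complex_of_real (gegenbauer k n t * r ^ n)) sums of_real ((1 - 2 * r * t + r\<^sup>2) powr (- k))"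
    by simp
  then show ?thesis by (simp only: sums_of_real_iff)
qed

text \<open>By \<open>gegenbauer_raise\<close> the terms are differences of terms of the generating
  series at \<open>k + 1\<close>, shifted by two; the shift produces the factor
  \<open>1 - r^2\<close>.\<close>

lemma sums_gegenbauer_poisson:
  assumes "k > 0" "\<bar>t\<bar> \<le> 1" "0 \<le> r" "r < 1"
  shows "(\<lambda>n. (real n + k) * gegenbauer k n t * r ^ n) sums (k * (1 - r\<^sup>2) / (1 - 2 * r * t + r\<^sup>2) powr (k + 1))"
proof -
  define S where "S = (1 - 2 * r * t + r\<^sup>2) powr (- (k + 1))"
  define q where "q n = gegenbauer (k+1) n t * r ^ n" for n
  have q: "q sums S"
    unfolding q_def S_def using assms by (intro sums_gegenbauer) auto
  have "(\<lambda>n. q (n + 2)) sums (S - (\<Sum>i<2. q i))"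
    using q by (rule sums_split_initial_segment)
  then have "(\<lambda>n. k * (q (n + 2) - r\<^sup>2 * q n)) sums (k * (S - (\<Sum>i<2. q i) - r\<^sup>2 * S))"
    by (intro sums_mult sums_diff q)
  moreover have "k * (q (n + 2) - r\<^sup>2 * q n) = (real (n + 2) + k) * gegenbauer k (n + 2) t * r ^ (n + 2)" for n
  proof -
    have "k * (q (n + 2) - r\<^sup>2 * q n) =
        k * (gegenbauer (k + 1) (Suc (Suc n)) t - gegenbauer (k + 1) n t) * r ^ (n + 2)"
      by (simp add: q_def power_add power2_eq_square algebra_simps)
    also have "\<dots> = (real n + 2 + k) * gegenbauer k (Suc (Suc n)) t * r ^ (n + 2)"
      by (simp only: gegenbauer_raise[OF assms(1), of n t])
    finally show ?thesis by (simp add: add_ac)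
  qed
  ultimately have "(\<lambda>n. (real (n + 2) + k) * gegenbauer k (n + 2) t * r ^ (n + 2)) sums (k * (S - (\<Sum>i<2. q i) - r\<^sup>2 * S))"
    by simp
  then have "(\<lambda>n. (real n + k) * gegenbauer k n t * r ^ n) sums
     (k * (S - (\<Sum>i<2. q i) - r\<^sup>2 * S) + (\<Sum>i<2. (real i + k) * gegenbauer k i t * r ^ i))"
    using sums_iff_shift'[of "\<lambda>n. (real n + k) * gegenbauer k n t * r ^ n" 2 "k * (S - (\<Sum>i<2. q i) - r\<^sup>2 * S) + (\<Sum>i<2. (real i + k) * gegenbauer k i t * r ^ i)"]
    by simp
  \<comment> \<open>\<open>gegenbauer_raise\<close> starts at index 2. For indices 0 and 1 the
    subtracted term is absent and the two sides agree directly.\<close>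
  moreover have "(\<Sum>i<2. (real i + k) * gegenbauer k i t * r ^ i) = k * (\<Sum>i<2. q i)"
    by (simp add: q_def numeral_2_eq_2 algebra_simps)
  ultimately have "(\<lambda>n. (real n + k) * gegenbauer k n t * r ^ n) sums (k * (1 - r\<^sup>2) * S)"
    by (simp add: algebra_simps)
  then show ?thesis unfolding S_def powr_minus_divide by simp
qed

section \<open>The product formula\<close>

definition jacobi_mass :: "real \<Rightarrow> real" where
  "jacobi_mass k = integral {-1..1} (\<lambda>u. (1 - u\<^sup>2) powr (k - 1))"

text \<open>The affine map \<open>(u + 1) / 2\<close> reduces to the Beta integral. For
  \<open>k < 1\<close> the weight is unbounded near the endpoints, so integrability has to come from
  there; absolute integrability is what survives multiplication by a continuous function.\<close>

lemma jacobi_weight_Beta: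
  assumes "k > 0"
  shows "(\<lambda>u. (1 - u\<^sup>2) powr (k - 1)) absolutely_integrable_on {-1..1::real}"
    and "jacobi_mass k = 2 powr (2 * k - 1) * Beta k k"
proof -
  define f where "f t = t powr (k - 1) * (1 - t) powr (k - 1)" for t :: real
  have f: "(f has_integral Beta k k) {0..1}"
    unfolding f_def by (rule has_integral_Beta_real[OF assms assms])
  have fa: "f absolutely_integrable_on {0..1}"
    by (rule nonnegative_absolutely_integrable_1) (use f in \<open>auto simp: f_def\<close>)
  define g where "g u = (u + 1) / 2" for u :: real
  have img: "g ` {-1..1} = {0..1}"
  proof -
    have "x \<in> g ` {-1..1}" if "x \<in> {0..1}" for x
      using that by (intro image_eqI[of _ _ "2 * x - 1"]) (auto simp: g_def)
    then show ?thesis by (auto simp: g_def)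
  qed
  have "(\<lambda>u. \<bar>1/2\<bar> * f (g u)) absolutely_integrable_on {-1..1} \<and> integral {-1..1} (\<lambda>u. \<bar>1/2\<bar> * f (g u)) = Beta k k"
    by (subst has_absolute_integral_change_of_variables_1'[where S = "{-1..1}" and g = g and g' = "\<lambda>_. 1/2"])
       (use fa f in \<open>auto simp: img simp del: abs_divide\<close>, auto simp: g_def[abs_def] inj_on_def intro!: derivative_eq_intros)
  moreover have e: "\<bar>1/2\<bar> * f (g u) = 2 powr (1 - 2 * k) * (1 - u\<^sup>2) powr (k - 1)" for u
  proof -
    have "f (g u) = (g u * (1 - g u)) powr (k - 1)" by (simp add: f_def powr_mult)
    also have "g u * (1 - g u) = (1 - u\<^sup>2) / 4" by (simp add: g_def power2_eq_square field_simps)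
    also have "\<dots> powr (k - 1) = (1 - u\<^sup>2) powr (k - 1) / 4 powr (k - 1)" by (rule powr_divide)
    also have "4 powr (k - 1) = 2 powr (2 * (k - 1))" unfolding powr_powr[symmetric] by simp
    finally show ?thesis by (simp add: powr_diff field_simps powr_minus)
  qed
  ultimately have ai: "(\<lambda>u. 2 powr (1 - 2 * k) * (1 - u\<^sup>2) powr (k - 1)) absolutely_integrable_on {-1..1}"
    and ie: "integral {-1..1} (\<lambda>u. 2 powr (1 - 2 * k) * (1 - u\<^sup>2) powr (k - 1)) = Beta k k"
    unfolding e by auto
  from ai show "(\<lambda>u. (1 - u\<^sup>2) powr (k - 1)) absolutely_integrable_on {-1..1::real}"
    using absolutely_integrable_scaleR_left[OF ai, of "2 powr (2 * k - 1)"]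
    by (simp add: mult.assoc[symmetric] powr_add[symmetric])
  have "2 powr (1 - 2 * k) * jacobi_mass k = Beta k k"
    using ie by (simp add: jacobi_mass_def)
  then show "jacobi_mass k = 2 powr (2 * k - 1) * Beta k k"
    by (simp add: powr_diff field_simps)
qed

lemma jacobi_mass_pos: "k > 0 \<Longrightarrow> jacobi_mass k > 0"
  by (simp add: jacobi_weight_Beta Beta_def Gamma_real_pos)

lemma jacobi_weight_times_continuous:
  assumes "k > 0" "continuous_on {-1..1} f"
  shows "(\<lambda>u. (1 - u\<^sup>2) powr (k - 1) * f u) absolutely_integrable_on {-1..1::real}"
proof -
  have "(\<lambda>u. f u * (1 - u\<^sup>2) powr (k - 1)) absolutely_integrable_on {-1..1::real}"
    by (intro absolutely_integrable_bounded_measurable_product_real jacobi_weight_Beta(1) assms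
        continuous_imp_measurable_on_sets_lebesgue compact_imp_bounded compact_continuous_image) auto
  then show ?thesis by (simp add: mult.commute)
qed

lemma jacobi_weight_integrable:
  assumes "k > 0" "continuous_on {-1..1} f"
  shows "(\<lambda>u. (1 - u\<^sup>2) powr (k - 1) * f u) integrable_on {-1..1::real}"
  using jacobi_weight_times_continuous[OF assms] by (rule set_lebesgue_integral_eq_integral)

text \<open>The derivative of \<open>(1 - u^2) powr k\<close> is
  \<open>- 2 * k * u * (1 - u^2) powr (k - 1)\<close>, and the boundary terms vanish for
  \<open>k > 0\<close>. Only the interior is differentiated, as the power may fail to be
  differentiable at the endpoints.\<close>

lemma jacobi_weight_by_parts:
  assumes "k > 0" "\<And>u. (f has_real_derivative f' u) (at u)" "continuous_on {-1..1} f'"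
  shows "2 * k * integral {-1..1} (\<lambda>u. (1 - u\<^sup>2) powr (k - 1) * (u * f u)) =
           integral {-1..1} (\<lambda>u. (1 - u\<^sup>2) powr k * f' u)"
proof -
  have cf: "continuous_on {-1..1} f"
    using assms(2) DERIV_isCont continuous_at_imp_continuous_on by blast
  have i1: "(\<lambda>u. (1 - u\<^sup>2) powr (k - 1) * (u * f u)) integrable_on {-1..1}"
    by (intro jacobi_weight_integrable assms continuous_intros cf)
  have i2: "(\<lambda>u. (1 - u\<^sup>2) powr k * f' u) integrable_on {-1..1}"
    using jacobi_weight_integrable[of "k+1" f'] assms by simp
  have "((\<lambda>u. (1 - u\<^sup>2) powr k * f' u - 2 * k * ((1 - u\<^sup>2) powr (k - 1) * (u * f u))) has_integral
      (1 - 1\<^sup>2) powr k * f 1 - (1 - (-1)\<^sup>2) powr k * f (-1)) {-1..1}"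
  proof (rule fundamental_theorem_of_calculus_interior)
    show "continuous_on {-1..1} (\<lambda>u. (1 - u\<^sup>2) powr k * f u)"
      by (intro continuous_intros cf continuous_on_powr') (use assms(1) in \<open>auto simp: abs_square_le_1 abs_le_iff\<close>)
    fix u :: real assume u: "u \<in> {-1<..<1}"
    then have p: "1 - u\<^sup>2 > 0" by (auto simp: abs_square_less_1 abs_less_iff)
    show "((\<lambda>u. (1 - u\<^sup>2) powr k * f u) has_vector_derivative
        (1 - u\<^sup>2) powr k * f' u - 2 * k * ((1 - u\<^sup>2) powr (k - 1) * (u * f u))) (at u)"
      unfolding has_real_derivative_iff_has_vector_derivative[symmetric]
      by (rule derivative_eq_intros assms(2) p refl | simp add: p)+
  qed simp
  from integral_unique[OF this]
  have "integral {-1..1} (\<lambda>u. (1 - u\<^sup>2) powr k * f' u - 2 * k * ((1 - u\<^sup>2) powr (k - 1) * (u * f u))) = 0"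
    by simp
  then show ?thesis
    using i1 i2 by (simp add: integral_diff integrable_on_mult_right)
qed

lemma jacobi_mass_Suc:
  assumes "k > 0"
  shows "(2 * k + 1) * jacobi_mass (k + 1) = 2 * k * jacobi_mass k"
proof -
  \<comment> \<open>At the endpoints both sides are \<open>0\<close>, since
    \<open>0 powr s = 0\<close> for every \<open>s\<close>.\<close>
  have w: "(1 - u\<^sup>2) powr (k - 1) - (1 - u\<^sup>2) powr (k - 1) * (u * u) = (1 - u\<^sup>2) powr k" if "u \<in> {-1..1}" for u :: real
  proof (cases "1 - u\<^sup>2 = 0")
    case False
    moreover have "1 - u\<^sup>2 \<ge> 0" using that by (auto simp: abs_square_le_1 abs_le_iff)
    ultimately have "(1 - u\<^sup>2) * (1 - u\<^sup>2) powr (k - 1) = (1 - u\<^sup>2) powr k"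
      by (simp add: powr_diff)
    then show ?thesis by (simp add: algebra_simps power2_eq_square)
  qed (use assms in \<open>simp\<close>)
  have "integral {-1..1} (\<lambda>u. (1 - u\<^sup>2) powr k) =
     integral {-1..1} (\<lambda>u. (1 - u\<^sup>2) powr (k - 1) - (1 - u\<^sup>2) powr (k - 1) * (u * u))"
    by (rule integral_cong) (use w in auto)
  also have "\<dots> = jacobi_mass k - integral {-1..1} (\<lambda>u. (1 - u\<^sup>2) powr (k - 1) * (u * u))"
    unfolding jacobi_mass_def
    using jacobi_weight_integrable[OF assms, of "\<lambda>_. 1"]
    by (intro integral_diff jacobi_weight_integrable assms continuous_intros) auto
  finally have "jacobi_mass (k + 1) = jacobi_mass k - integral {-1..1} (\<lambda>u. (1 - u\<^sup>2) powr (k - 1) * (u * u))"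
    by (simp add: jacobi_mass_def)
  then have "2 * k * jacobi_mass (k + 1) = 2 * k * jacobi_mass k - 2 * k * integral {-1..1} (\<lambda>u. (1 - u\<^sup>2) powr (k - 1) * (u * u))"
    by (simp only: right_diff_distrib)
  also have "2 * k * integral {-1..1} (\<lambda>u. (1 - u\<^sup>2) powr (k - 1) * (u * u)) = jacobi_mass (k + 1)"
    unfolding jacobi_mass_def
    using jacobi_weight_by_parts[OF assms, of "\<lambda>u. u" "\<lambda>_. 1"] by simp
  finally show ?thesis by (simp add: algebra_simps)
qed

lemma continuous_on_gegenbauer [continuous_intros]:
  assumes "continuous_on S f"
  shows "continuous_on S (\<lambda>x. gegenbauer k n (f x))"
  \<comment> \<open>The value \<open>0\<close> only instantiates the third argument of the induction
    rule; the claim does not mention it.\<close>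
  by (induction k n "0::real" rule: gegenbauer.induct)
     (auto simp: gegenbauer.simps(3) intro!: continuous_intros assms)

text \<open>Not normalised: the total mass is \<open>jacobi_mass k\<close>. Keeping \<open>a\<close>
  and \<open>b\<close> free makes the recurrence for the means algebraic; later they are
  \<open>cos x * cos y\<close> and \<open>sin x * sin y\<close>.\<close>

definition gegenbauer_mean :: "real \<Rightarrow> nat \<Rightarrow> real \<Rightarrow> real \<Rightarrow> real" where
  "gegenbauer_mean k n a b = integral {-1..1} (\<lambda>u. (1 - u\<^sup>2) powr (k - 1) * gegenbauer k n (a + u * b))"

text \<open>Integration by parts trades the factor \<open>u\<close> for a derivative in
  \<open>u\<close>: the inner derivative gives \<open>b\<close>, and both the weight and the
  polynomial pass to parameter \<open>k + 1\<close>.\<close>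

lemma gegenbauer_mean_odd:
  assumes "k > 0"
  shows "integral {-1..1} (\<lambda>u. (1 - u\<^sup>2) powr (k - 1) * (u * gegenbauer k (Suc n) (a + u * b))) =
           b * gegenbauer_mean (k + 1) n a b"
    and "integral {-1..1} (\<lambda>u. (1 - u\<^sup>2) powr (k - 1) * (u * gegenbauer k 0 (a + u * b))) = 0"
proof -
  have "2 * k * integral {-1..1} (\<lambda>u. (1 - u\<^sup>2) powr (k - 1) * (u * gegenbauer k (Suc n) (a + u * b))) =
      integral {-1..1} (\<lambda>u. (1 - u\<^sup>2) powr k * (2 * k * gegenbauer (k + 1) n (a + u * b) * b))"
  proof (rule jacobi_weight_by_parts[OF assms])
    fix u
    show "((\<lambda>u. gegenbauer k (Suc n) (a + u * b)) has_real_derivative 2 * k * gegenbauer (k + 1) n (a + u * b) * b) (at u)"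
      by (rule DERIV_chain2[OF gegenbauer_has_derivative[OF assms]]) (auto intro!: derivative_eq_intros)
  qed (intro continuous_intros)
  also have "\<dots> = integral {-1..1} (\<lambda>u. (2 * k * b) * ((1 - u\<^sup>2) powr k * gegenbauer (k + 1) n (a + u * b)))"
    by (simp add: mult_ac)
  also have "\<dots> = 2 * k * (b * gegenbauer_mean (k + 1) n a b)"
    unfolding gegenbauer_mean_def by simp
  finally show "integral {-1..1} (\<lambda>u. (1 - u\<^sup>2) powr (k - 1) * (u * gegenbauer k (Suc n) (a + u * b))) =
           b * gegenbauer_mean (k + 1) n a b"
    using assms by simp
  show "integral {-1..1} (\<lambda>u. (1 - u\<^sup>2) powr (k - 1) * (u * gegenbauer k 0 (a + u * b))) = 0"
    using jacobi_weight_by_parts[OF assms, of "\<lambda>_. 1" "\<lambda>_. 0"] assms by simp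
qed

text \<open>The three-term recurrence at \<open>a + u * b\<close>, integrated. The part multiplied
  by \<open>u * b\<close> is evaluated by \<open>gegenbauer_mean_odd\<close>, which is how
  \<open>b^2\<close> and the parameter \<open>k + 1\<close> enter.\<close>

lemma gegenbauer_mean_rec:
  assumes "k > 0"
  shows "(real n + 2) * gegenbauer_mean k (Suc (Suc n)) a b =
     2 * (real n + 1 + k) * (a * gegenbauer_mean k (Suc n) a b + b\<^sup>2 * gegenbauer_mean (k + 1) n a b)
     - (real n + 2 * k) * gegenbauer_mean k n a b"
proof -
  let ?w = "\<lambda>u::real. (1 - u\<^sup>2) powr (k - 1)"
  let ?g = "\<lambda>j u. gegenbauer k j (a + u * b)"
  have i: "(\<lambda>u. ?w u * ?g j u) integrable_on {-1..1}" "(\<lambda>u. ?w u * (u * ?g j u)) integrable_on {-1..1}" for j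
    by (intro jacobi_weight_integrable assms continuous_intros)+
  have pt: "(real n + 2) * (?w u * ?g (Suc (Suc n)) u) =
      2 * (real n + 1 + k) * (a * (?w u * ?g (Suc n) u) + b * (?w u * (u * ?g (Suc n) u))) - (real n + 2 * k) * (?w u * ?g n u)" for u
    unfolding gegenbauer.simps(3) by (simp add: divide_simps) (simp add: algebra_simps)
  have "(real n + 2) * gegenbauer_mean k (Suc (Suc n)) a b = integral {-1..1} (\<lambda>u. (real n + 2) * (?w u * ?g (Suc (Suc n)) u))"
    unfolding gegenbauer_mean_def by simp
  also have "\<dots> = integral {-1..1} (\<lambda>u. 2 * (real n + 1 + k) * (a * (?w u * ?g (Suc n) u) + b * (?w u * (u * ?g (Suc n) u))) - (real n + 2 * k) * (?w u * ?g n u))"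
    unfolding pt ..
  also have "\<dots> = 2 * (real n + 1 + k) * (a * gegenbauer_mean k (Suc n) a b + b * integral {-1..1} (\<lambda>u. ?w u * (u * ?g (Suc n) u))) - (real n + 2 * k) * gegenbauer_mean k n a b"
    unfolding gegenbauer_mean_def using i
    by (simp add: integral_diff integral_add integrable_on_mult_right integrable_add del: distrib_left_numeral)
  finally show ?thesis unfolding gegenbauer_mean_odd(1)[OF assms] by (simp add: power2_eq_square algebra_simps)
qed

text \<open>
  The means satisfy a recurrence that couples the parameters \<open>k\<close> and \<open>k + 1\<close>. Writing \<open>X C\<close> and
  \<open>(1 - X\<^sup>2) C'\<close> as combinations of the neighbours of \<open>C\<close>, the mixed terms of the two products cancel.
\<close>

theorem gegenbauer_product_formula:
  assumes "k > 0" "S\<^sup>2 = 1 - X\<^sup>2" "T\<^sup>2 = 1 - Y\<^sup>2"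
  shows "gegenbauer_mean k n (X * Y) (S * T) * gegenbauer k n 1 = jacobi_mass k * gegenbauer k n X * gegenbauer k n Y"
  using assms(1)
\<comment> \<open>\<open>k\<close> is generalised because the recurrence for the means uses the
  induction hypothesis at \<open>k + 1\<close>.\<close>
proof (induction n arbitrary: k rule: less_induct)
  case (less n)
  consider "n = 0" | "n = 1" | m where "n = Suc (Suc m)"
    by (metis One_nat_def not0_implies_Suc)
  then show ?case
  proof cases
    case 1
    then show ?thesis by (simp add: gegenbauer_mean_def jacobi_mass_def)
  next
    case 2
    have "gegenbauer_mean k 1 (X * Y) (S * T) =
       integral {-1..1} (\<lambda>u. 2 * k * (X * Y) * ((1 - u\<^sup>2) powr (k - 1) * 1) + 2 * k * (S * T) * ((1 - u\<^sup>2) powr (k - 1) * (u * 1)))"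
      unfolding gegenbauer_mean_def by (simp add: algebra_simps)
    also have "\<dots> = 2 * k * (X * Y) * integral {-1..1} (\<lambda>u. (1 - u\<^sup>2) powr (k - 1) * 1)
        + 2 * k * (S * T) * integral {-1..1} (\<lambda>u. (1 - u\<^sup>2) powr (k - 1) * (u * 1))"
      by (subst integral_add)
        (intro integrable_on_mult_right jacobi_weight_integrable less.prems continuous_intros | simp)+
    also have "integral {-1..1} (\<lambda>u. (1 - u\<^sup>2) powr (k - 1) * (u * 1)) = 0"
      using gegenbauer_mean_odd(2)[OF less.prems] by simp
    finally show ?thesis using 2 by (simp add: jacobi_mass_def)
  next
    case 3
    define M0 M1 M2 M' where "M0 = gegenbauer_mean k m (X * Y) (S * T)" and "M1 = gegenbauer_mean k (Suc m) (X * Y) (S * T)"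
      and "M2 = gegenbauer_mean k n (X * Y) (S * T)" and "M' = gegenbauer_mean (k+1) m (X * Y) (S * T)"
    define g0 g1 g2 g' where "g0 = gegenbauer k m 1" and "g1 = gegenbauer k (Suc m) 1"
      and "g2 = gegenbauer k n 1" and "g' = gegenbauer (k+1) m 1"
    define p0 p1 p2 p' where "p0 = gegenbauer k m X" and "p1 = gegenbauer k (Suc m) X"
      and "p2 = gegenbauer k n X" and "p' = gegenbauer (k+1) m X"
    define q0 q1 q2 q' where "q0 = gegenbauer k m Y" and "q1 = gegenbauer k (Suc m) Y"
      and "q2 = gegenbauer k n Y" and "q' = gegenbauer (k+1) m Y"
    define c where "c = jacobi_mass k"
    define N where "N = real m + 1 + k"
    have k: "k > 0" by fact
    have pos: "N > 0" "g0 > 0" "g1 > 0" "g2 > 0" "g' > 0"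
      using k gegenbauer_one_pos by (simp_all add: N_def g0_def g1_def g2_def g'_def)
    have m: "real m = N - 1 - k" by (simp add: N_def)
    have N: "N > k" "N + k > 1" "N - k \<ge> 1" using k by (auto simp: N_def)
    have M0: "M0 = c * p0 * q0 / g0"
      using less.IH[of m k] 3 k pos by (simp add: M0_def c_def p0_def q0_def g0_def field_simps)
    have M1: "M1 = c * p1 * q1 / g1"
      using less.IH[of "Suc m" k] 3 k pos by (simp add: M1_def c_def p1_def q1_def g1_def field_simps)
    have "jacobi_mass (k + 1) = 2 * k * c / (2 * k + 1)"
      using jacobi_mass_Suc[OF k] k by (simp add: c_def field_simps)
    then have "M' * g' = (2 * k * c / (2 * k + 1)) * p' * q'"
      using less.IH[of m "k + 1"] 3 k by (simp add: M'_def p'_def q'_def g'_def)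
    then have M': "M' = (2 * k * c / (2 * k + 1)) * p' * q' / g'"
      using pos by (metis less_irrefl nonzero_eq_divide_eq)
    have G0: "g0 = (N - k) * g1 / (N - 1 + k)"
      using gegenbauer_one_Suc[of m k] N unfolding m g0_def g1_def by (simp add: field_simps)
    have G2: "g2 = (N + k) * g1 / (N - k + 1)"
      using gegenbauer_one_Suc[of "Suc m" k] N unfolding g2_def 3 g1_def of_nat_Suc m by (simp add: field_simps)
    have G': "g' = (N - k) * (N + k) * g1 / (2 * k * (2 * k + 1))"
    proof -
      have "g' * (2 * k * (2 * k + 1)) = (N - k) * (N + k) * g1"
        using gegenbauer_one_raise[of k m] unfolding g'_def g1_def m by (simp add: algebra_simps)
      then show ?thesis using k by (subst nonzero_eq_divide_eq) auto
    qed
    have Xp: "X * p1 = ((N - k + 1) * p2 + (N - 1 + k) * p0) / (2 * N)"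
      using gegenbauer_mult_arg'[OF k, of X m] unfolding p0_def p1_def p2_def 3 m by (simp add: algebra_simps)
    have Yq: "Y * q1 = ((N - k + 1) * q2 + (N - 1 + k) * q0) / (2 * N)"
      using gegenbauer_mult_arg'[OF k, of Y m] unfolding q0_def q1_def q2_def 3 m by (simp add: algebra_simps)
    have Xp': "(1 - X\<^sup>2) * p' = ((N - 1 + k) * (N + k) * p0 - (N - k) * (N - k + 1) * p2) / (4 * k * N)"
      using gegenbauer_lower[OF k, of m X] k pos unfolding p0_def p'_def p2_def 3 m by (simp add: field_simps)
    have Yq': "(1 - Y\<^sup>2) * q' = ((N - 1 + k) * (N + k) * q0 - (N - k) * (N - k + 1) * q2) / (4 * k * N)"
      using gegenbauer_lower[OF k, of m Y] k pos unfolding q0_def q'_def q2_def 3 m by (simp add: field_simps)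
    have "(N - k + 1) * M2 = 2 * N * (X * Y * M1 + (S * T)\<^sup>2 * M') - (N - 1 + k) * M0"
      using gegenbauer_mean_rec[OF k, of m "X * Y" "S * T"] unfolding M0_def M1_def M2_def M'_def 3 m
      by (simp add: algebra_simps)
    also have "X * Y * M1 = c * (X * p1) * (Y * q1) / g1" by (simp add: M1)
    also have "(S * T)\<^sup>2 * M' = (2 * k * c / (2 * k + 1)) * ((1 - X\<^sup>2) * p') * ((1 - Y\<^sup>2) * q') / g'"
      by (simp add: M' power_mult_distrib assms)
    finally have M2: "(N - k + 1) * M2 = 2 * N * (c * (X * p1) * (Y * q1) / g1 +
        (2 * k * c / (2 * k + 1)) * ((1 - X\<^sup>2) * p') * ((1 - Y\<^sup>2) * q') / g') - (N - 1 + k) * M0" .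
    define a b d e where "a = N - k + 1" and "b = N - 1 + k" and "d = N + k" and "e = N - k"
    have abde: "a > 0" "b > 0" "d > 0" "e > 0" "d + e = 2 * N"
      using N k pos by (auto simp: a_def b_def d_def e_def)
    have 1: "c * (X * p1) * (Y * q1) / g1 = c * ((a * p2 + b * p0) * (a * q2 + b * q0)) / (4 * N\<^sup>2 * g1)"
      unfolding Xp Yq a_def[symmetric] b_def[symmetric] using pos by (simp add: power2_eq_square)
    have 2: "(2 * k * c / (2 * k + 1)) * ((1 - X\<^sup>2) * p') * ((1 - Y\<^sup>2) * q') / g' =
        c * ((b * d * p0 - e * a * p2) * (b * d * q0 - e * a * q2)) / (4 * N\<^sup>2 * g1 * (e * d))"
    proof -
      define U V where "U = b * d * p0 - e * a * p2" and "V = b * d * q0 - e * a * q2"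
      have "2 * k + 1 > 0" using k by simp
      then have "(2 * k * c / (2 * k + 1)) * (U / (4 * k * N)) * (V / (4 * k * N)) / (e * d * g1 / (2 * k * (2 * k + 1)))
         = c * (U * V) / (4 * N\<^sup>2 * g1 * (e * d))"
        using k pos abde by (simp add: divide_simps power2_eq_square)
      then show ?thesis
        unfolding Xp' Yq' G' U_def V_def by (simp add: a_def b_def d_def e_def)
    qed
    have 3: "(N - 1 + k) * M0 = c * (b\<^sup>2 * (p0 * q0)) / (e * g1)"
      unfolding M0 G0 using pos abde by (simp add: a_def b_def d_def e_def power2_eq_square)
    \<comment> \<open>The mixed products \<open>p2 * q0\<close> and \<open>p0 * q2\<close> occur
      with coefficients \<open>a * b * d * e\<close> of opposite sign; the pure ones collect the
      factor \<open>d + e = 2 * N\<close>.\<close>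
    have 4: "(a * p2 + b * p0) * (a * q2 + b * q0) * (e * d) + (b * d * p0 - e * a * p2) * (b * d * q0 - e * a * q2)
       = 2 * N * (a\<^sup>2 * e * (p2 * q2) + b\<^sup>2 * d * (p0 * q0))"
      unfolding abde(5)[symmetric] by algebra
    have "c * ((a * p2 + b * p0) * (a * q2 + b * q0)) / (4 * N\<^sup>2 * g1) +
        c * ((b * d * p0 - e * a * p2) * (b * d * q0 - e * a * q2)) / (4 * N\<^sup>2 * g1 * (e * d))
      = c * ((a * p2 + b * p0) * (a * q2 + b * q0) * (e * d) + (b * d * p0 - e * a * p2) * (b * d * q0 - e * a * q2)) / (4 * N\<^sup>2 * g1 * (e * d))"
      using pos abde by (simp add: distrib_left add_divide_distrib)
    also have "\<dots> = c * (a\<^sup>2 * e * (p2 * q2) + b\<^sup>2 * d * (p0 * q0)) / (2 * N * g1 * (e * d))"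
      unfolding 4 using pos(1) by (simp add: power2_eq_square del: distrib_left_numeral)
    \<comment> \<open>The \<open>p0 * q0\<close> contribution equals the subtracted
      \<open>M0\<close> term, so only \<open>p2 * q2\<close> remains.\<close>
    finally have "a * M2 = 2 * N * (c * (a\<^sup>2 * e * (p2 * q2) + b\<^sup>2 * d * (p0 * q0)) / (2 * N * g1 * (e * d))) - c * (b\<^sup>2 * (p0 * q0)) / (e * g1)"
      using M2 unfolding 1 2 3 a_def[symmetric] by simp
    also have "\<dots> = c * a\<^sup>2 * (p2 * q2) / (d * g1)"
      using pos(1,3) abde(3,4) by (simp add: add_divide_distrib distrib_left mult_ac)
    finally have "a * M2 = a * (c * p2 * q2 / g2)"
      unfolding G2 using pos abde by (simp add: a_def d_def power2_eq_square)
    then have "M2 = c * p2 * q2 / g2" using abde(1) by (metis less_irrefl mult_left_cancel)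
    then show ?thesis using pos by (simp add: M2_def g2_def c_def p2_def q2_def field_simps)
  qed
qed

section \<open>Masses of the two weights\<close>

lemma integral_abs_sin_powr:
  assumes "k > 0"
  shows "integral {-pi..pi} (\<lambda>x. \<bar>sin x\<bar> powr (2 * k)) = 2 * jacobi_mass (k + 1/2)"
proof -
  have img: "cos ` {0..pi} = {-1..1}"
  proof -
    have "u \<in> cos ` {0..pi}" if "u \<in> {-1..1}" for u
      using that by (intro image_eqI[of _ _ "arccos u"]) (auto simp: arccos_lbound arccos_ubound)
    then show ?thesis by auto
  qed
  \<comment> \<open>Under \<open>u = cos x\<close> one factor \<open>sin x\<close> is spent on the
    derivative, which leaves the exponent \<open>k - 1/2\<close> and hence the parameter
    \<open>k + 1/2\<close>.\<close>
  have j: "(\<lambda>u. (1 - u\<^sup>2) powr (k + 1/2 - 1)) absolutely_integrable_on cos ` {0..pi}"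
    unfolding img using assms by (intro jacobi_weight_Beta(1)) auto
  have d: "(cos has_field_derivative - sin x) (at x within {0..pi})" if "x \<in> {0..pi}" for x
    by (auto intro!: derivative_eq_intros)
  have inj: "inj_on cos {0..pi}" by (auto simp: inj_on_def cos_inj_pi)
  have "integral {0..pi} (\<lambda>x. \<bar>- sin x\<bar> * (1 - (cos x)\<^sup>2) powr (k + 1/2 - 1)) = jacobi_mass (k + 1/2)"
    using has_absolute_integral_change_of_variables_1'[OF _ d inj, of "\<lambda>u. (1 - u\<^sup>2) powr (k + 1/2 - 1)" "jacobi_mass (k + 1/2)"] j
    unfolding img by (simp add: jacobi_mass_def)
  also have "integral {0..pi} (\<lambda>x. \<bar>- sin x\<bar> * (1 - (cos x)\<^sup>2) powr (k + 1/2 - 1)) =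
     integral {0..pi} (\<lambda>x. \<bar>sin x\<bar> powr (2 * k))"
  proof (rule integral_cong)
    fix x :: real
    have "1 - (cos x)\<^sup>2 = \<bar>sin x\<bar> powr 2"
      by (simp add: sin_squared_eq)
    then have "(1 - (cos x)\<^sup>2) powr (k + 1/2 - 1) = \<bar>sin x\<bar> powr (2 * (k + 1/2 - 1))" by (simp only: powr_powr)
    then show "\<bar>- sin x\<bar> * (1 - (cos x)\<^sup>2) powr (k + 1/2 - 1) = \<bar>sin x\<bar> powr (2 * k)"
      by (cases "sin x = 0") (simp_all add: powr_mult_base)
  qed
  finally have pos: "integral {0..pi} (\<lambda>x. \<bar>sin x\<bar> powr (2 * k)) = jacobi_mass (k + 1/2)" .
  have neg: "integral {-pi..0} (\<lambda>x. \<bar>sin x\<bar> powr (2 * k)) = integral {0..pi} (\<lambda>x. \<bar>sin x\<bar> powr (2 * k))"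
    using Henstock_Kurzweil_Integration.integral_reflect_real[of pi 0 "\<lambda>x. \<bar>sin x\<bar> powr (2 * k)"]
    by (simp del: Henstock_Kurzweil_Integration.integral_reflect_real)
  have "(\<lambda>x. \<bar>sin x\<bar> powr (2 * k)) integrable_on {-pi..pi}"
    using assms by (intro integrable_continuous_interval continuous_intros continuous_on_powr') auto
  then have "integral {-pi..0} (\<lambda>x. \<bar>sin x\<bar> powr (2 * k)) + integral {0..pi} (\<lambda>x. \<bar>sin x\<bar> powr (2 * k))
     = integral {-pi..pi} (\<lambda>x. \<bar>sin x\<bar> powr (2 * k))"
    by (intro Henstock_Kurzweil_Integration.integral_combine) auto
  then show ?thesis using pos neg by simp
qed

lemma Gamma_duplication_real:
  assumes "x > (0::real)"
  shows "Gamma x * Gamma (x + 1/2) = 2 powr (1 - 2 * x) * sqrt pi * Gamma (2 * x)"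
proof -
  have "complex_of_real (Gamma x * Gamma (x + 1/2)) = Gamma (of_real x) * Gamma (of_real x + 1/2)"
    using Gamma_complex_of_real[of "x + 1/2"] by (simp add: Gamma_complex_of_real)
  also have "\<dots> = exp ((1 - 2 * of_real x) * of_real (ln 2)) * of_real (sqrt pi) * Gamma (2 * of_real x)"
    using assms by (intro Gamma_legendre_duplication) (auto elim!: nonpos_Ints_cases simp: complex_eq_iff)
  also have "\<dots> = complex_of_real (exp ((1 - 2 * x) * ln 2) * sqrt pi * Gamma (2 * x))"
    using Gamma_complex_of_real[of "2 * x"] by (simp flip: exp_of_real)
  finally show ?thesis unfolding of_real_eq_iff by (simp add: powr_def)
qed

text \<open>The two masses are Beta integrals at \<open>k + 1/2\<close> and \<open>k\<close>. The
  duplication formula collapses their product, and all Gamma values cancel.\<close>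

lemma sin_mass_jacobi_mass:
  assumes "k > 0"
  shows "k * jacobi_mass k * integral {-pi..pi} (\<lambda>x. \<bar>sin x\<bar> powr (2 * k)) = 2 * pi"
proof -
  define G where "G = Gamma (2 * k)"
  have G: "G > 0" using assms by (simp add: G_def Gamma_real_pos)
  have "jacobi_mass k * jacobi_mass (k + 1/2) =
      2 powr (2 * k - 1) * 2 powr (2 * k) * (Gamma k * Gamma (k + 1/2))\<^sup>2 / (G * Gamma (2 * k + 1))"
    using assms by (simp add: jacobi_weight_Beta(2) Beta_def G_def power2_eq_square algebra_simps)
  also have "Gamma (2 * k + 1) = 2 * k * G"
    using Gamma_plus1[of "2 * k"] assms by (simp add: G_def nonpos_Ints_def)
  also have "Gamma k * Gamma (k + 1/2) = 2 powr (1 - 2 * k) * sqrt pi * G"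
    unfolding G_def by (rule Gamma_duplication_real[OF assms])
  also have "2 powr (2 * k - 1) * 2 powr (2 * k) * (2 powr (1 - 2 * k) * sqrt pi * G)\<^sup>2 / (G * (2 * k * G)) = pi / k"
    using G assms by (simp add: powr_diff power2_eq_square field_simps)
  finally have "jacobi_mass k * jacobi_mass (k + 1/2) = pi / k" .
  then have "k * jacobi_mass k * (2 * jacobi_mass (k + 1/2)) = 2 * pi"
    using assms by (simp add: nonzero_eq_divide_eq mult_ac)
  then show ?thesis by (simp only: integral_abs_sin_powr[OF assms])
qed

section \<open>Orthogonality and norms\<close>

definition sin_integral :: "real \<Rightarrow> (real \<Rightarrow> real) \<Rightarrow> real" where
  "sin_integral k f = integral {-pi..pi} (\<lambda>x. \<bar>sin x\<bar> powr (2 * k) * f x)"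

lemma continuous_on_sin_weight:
  fixes k :: real
  assumes "k > 0"
  shows "continuous_on S (\<lambda>x::real. \<bar>sin x\<bar> powr (2 * k))"
  using assms by (intro continuous_intros continuous_on_powr') auto

lemma sin_weight_integrable:
  assumes "k > 0" "continuous_on {-pi..pi} f"
  shows "(\<lambda>x. \<bar>sin x\<bar> powr (2 * k) * f x) integrable_on {-pi..pi}"
  by (intro integrable_continuous_interval continuous_on_mult continuous_on_sin_weight assms)

lemma sin_integral_linear:
  assumes "k > 0" "continuous_on {-pi..pi} f" "continuous_on {-pi..pi} g"
  shows "sin_integral k (\<lambda>x. a * f x + b * g x) = a * sin_integral k f + b * sin_integral k g"
proof -
  have "sin_integral k (\<lambda>x. a * f x + b * g x) =
     integral {-pi..pi} (\<lambda>x. a * (\<bar>sin x\<bar> powr (2 * k) * f x) + b * (\<bar>sin x\<bar> powr (2 * k) * g x))"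
    unfolding sin_integral_def by (simp add: algebra_simps)
  also have "\<dots> = a * sin_integral k f + b * sin_integral k g"
    unfolding sin_integral_def using sin_weight_integrable assms
    by (simp add: integral_add integrable_on_mult_right)
  finally show ?thesis .
qed

lemma sin_integral_cmult: "sin_integral k (\<lambda>x. a * f x) = a * sin_integral k f"
  unfolding sin_integral_def by (simp add: mult.left_commute)

lemma sin_integral_odd:
  assumes "\<And>x. f (- x) = - f x"
  shows "sin_integral k f = 0"
proof -
  have "sin_integral k f = integral {-pi..pi} (\<lambda>x. (\<lambda>x. \<bar>sin x\<bar> powr (2 * k) * f x) (- x))"
    using Henstock_Kurzweil_Integration.integral_reflect_real[of pi "-pi" "\<lambda>x. \<bar>sin x\<bar> powr (2 * k) * f x"]
    by (simp add: sin_integral_def del: Henstock_Kurzweil_Integration.integral_reflect_real)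
  also have "\<dots> = - sin_integral k f"
    by (simp add: sin_integral_def assms)
  finally show ?thesis by simp
qed

text \<open>The reason why the odd basis function
  \<open>sin x * gegenbauer (k + 1) n (cos x)\<close> has parameter \<open>k + 1\<close>: its norm
  and inner products become Gegenbauer integrals for that weight.\<close>

lemma sin_integral_sin_square:
  "sin_integral k (\<lambda>x. (sin x)\<^sup>2 * f x) = sin_integral (k + 1) f"
  unfolding sin_integral_def
proof (rule integral_cong)
  fix x :: real
  have "\<bar>sin x\<bar> powr (2 * (k + 1)) = \<bar>sin x\<bar> powr (2 * k) * \<bar>sin x\<bar> powr 2"
    unfolding powr_add[symmetric] by (simp add: algebra_simps)
  also have "\<bar>sin x\<bar> powr 2 = (sin x)\<^sup>2" by simp
  finally show "\<bar>sin x\<bar> powr (2 * k) * ((sin x)\<^sup>2 * f x) = \<bar>sin x\<bar> powr (2 * (k + 1)) * f x" by simp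
qed

text \<open>
  The Gegenbauer differential equation in divergence form: it exhibits \<open>|sin|\<^sup>2\<^sup>k C\<close> as a derivative.
\<close>

lemma gegenbauer_divergence:
  assumes "k > 0"
  obtains d where "(gegenbauer (k + 1) n has_real_derivative d) (at t)"
    "(2 * k + 1) * t * gegenbauer (k + 1) n t - (1 - t\<^sup>2) * d =
       (real n + 1) * (real n + 1 + 2 * k) / (2 * k) * gegenbauer k (Suc n) t"
\<comment> \<open>The derivative is only asserted to exist because its formula refers to index
  \<open>n - 1\<close>, whereas for \<open>n = 0\<close> it is \<open>0\<close>.\<close>
proof (cases n)
  case 0
  have e: "gegenbauer (k + 1) 0 = (\<lambda>t. 1)" by (rule ext) simp
  show ?thesis by (rule that[of 0]) (use assms 0 e in auto)
next
  case (Suc m)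
  define q where "q j = gegenbauer (k+1) j t" for j
  define M where "M = real m + 2 + k"
  have m: "real m = M - 2 - k" "M > 0" using assms by (simp_all add: M_def)
  have l: "(1 - t\<^sup>2) * (2 * (k + 1) * gegenbauer (k + 1 + 1) m t) =
     ((M + k) * (M + k + 1) * q m - (M - k - 1) * (M - k) * q (Suc (Suc m))) / (2 * M)"
    using gegenbauer_lower[of "k + 1" m t] assms m(2) unfolding m(1) q_def by (simp add: field_simps)
  have tq: "t * q (Suc m) = ((M - k) * q (Suc (Suc m)) + (M + k) * q m) / (2 * M)"
    using gegenbauer_mult_arg'[of "k + 1" t m] assms unfolding m(1) q_def by (simp add: algebra_simps)
  have c: "gegenbauer k (Suc (Suc m)) t = k * (q (Suc (Suc m)) - q m) / M"
    using gegenbauer_raise[OF assms, of m t] m(2) unfolding m(1) q_def by (simp add: field_simps)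
  show ?thesis
  proof (rule that)
    show "(gegenbauer (k + 1) n has_real_derivative 2 * (k + 1) * gegenbauer (k + 1 + 1) m t) (at t)"
      unfolding Suc using assms by (intro gegenbauer_has_derivative) auto
    have "(2 * k + 1) * (t * q (Suc m)) - (1 - t\<^sup>2) * (2 * (k + 1) * gegenbauer (k + 1 + 1) m t) =
       (M - k) * (M + k) / (2 * k) * gegenbauer k (Suc (Suc m)) t"
      unfolding l tq c using assms m(2) by (simp add: divide_simps) (simp add: algebra_simps)
    then show "(2 * k + 1) * t * gegenbauer (k + 1) n t - (1 - t\<^sup>2) * (2 * (k + 1) * gegenbauer (k + 1 + 1) m t) =
       (real n + 1) * (real n + 1 + 2 * k) / (2 * k) * gegenbauer k (Suc n) t"
      unfolding Suc of_nat_Suc m(1) q_def by (simp add: algebra_simps)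
  qed
qed

text \<open>Orthogonality to constants: by \<open>gegenbauer_divergence\<close> the integrand is, up
  to the constant \<open>C\<close>, the derivative of \<open>H\<close>, which vanishes at both ends
  because of \<open>sin x\<close>.\<close>

lemma sin_integral_gegenbauer:
  assumes "k > 0"
  shows "sin_integral k (\<lambda>x. gegenbauer k (Suc n) (cos x)) = 0"
proof -
  define C where "C = (real n + 1) * (real n + 1 + 2 * k) / (2 * k)"
  have C: "C > 0" using assms by (simp add: C_def add_pos_nonneg)
  have w: "\<bar>sin x\<bar> powr (2 * k) = (sin x)\<^sup>2 powr k" for x :: real
    using powr_powr[of "\<bar>sin x\<bar>" 2 k] by simp
  define H where "H x = (sin x)\<^sup>2 powr k * (sin x * gegenbauer (k + 1) n (cos x))" for x
  have "((\<lambda>x. C * (\<bar>sin x\<bar> powr (2 * k) * gegenbauer k (Suc n) (cos x))) has_integral (H pi - H (-pi))) {-pi..pi}"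
  \<comment> \<open>The computation of the derivative divides by \<open>sin x\<close>, so the
    interior zero at \<open>0\<close> is made an exceptional point.\<close>
  proof (rule fundamental_theorem_of_calculus_interior_strong[where S = "{0}"])
    show "continuous_on {-pi..pi} H"
      unfolding H_def w[symmetric] by (intro continuous_intros continuous_on_sin_weight assms)
    fix x assume x: "x \<in> {-pi<..<pi} - {0}"
    have s: "sin x \<noteq> 0"
    proof
      assume "sin x = 0"
      with x show False using sin_eq_0_pi[of x] by auto
    qed
    then have p: "(sin x)\<^sup>2 > 0" by simp
    obtain d where d: "(gegenbauer (k + 1) n has_real_derivative d) (at (cos x))"
      "(2 * k + 1) * cos x * gegenbauer (k + 1) n (cos x) - (1 - (cos x)\<^sup>2) * d = C * gegenbauer k (Suc n) (cos x)"
      using gegenbauer_divergence[OF assms, of n "cos x"] unfolding C_def by metis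
    have dc: "((\<lambda>x. gegenbauer (k + 1) n (cos x)) has_real_derivative d * (- sin x)) (at x)"
      by (rule DERIV_chain2[where f = "gegenbauer (k + 1) n" and g = cos, OF d(1)]) (auto intro!: derivative_eq_intros)
    have dw: "((\<lambda>x. (sin x)\<^sup>2 powr k) has_real_derivative k * (sin x)\<^sup>2 powr (k - 1) * (2 * sin x * cos x)) (at x)"
      by (rule derivative_eq_intros refl | use s in simp)+
    have dw': "k * (sin x)\<^sup>2 powr (k - 1) * (2 * sin x * cos x) = 2 * k * (sin x)\<^sup>2 powr k * cos x / sin x"
      using s p by (simp add: powr_diff power2_eq_square)
    have "(H has_real_derivative
        2 * k * (sin x)\<^sup>2 powr k * cos x / sin x * (sin x * gegenbauer (k + 1) n (cos x)) +
        (cos x * gegenbauer (k + 1) n (cos x) + d * (- sin x) * sin x) * (sin x)\<^sup>2 powr k) (at x)"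
      unfolding H_def by (intro DERIV_mult dw[unfolded dw'] dc DERIV_sin)
    also have "2 * k * (sin x)\<^sup>2 powr k * cos x / sin x * (sin x * gegenbauer (k + 1) n (cos x)) +
        (cos x * gegenbauer (k + 1) n (cos x) + d * (- sin x) * sin x) * (sin x)\<^sup>2 powr k =
        (sin x)\<^sup>2 powr k * ((2 * k + 1) * cos x * gegenbauer (k + 1) n (cos x) - (sin x)\<^sup>2 * d)"
      using s by (simp add: algebra_simps power2_eq_square)
    also have "(2 * k + 1) * cos x * gegenbauer (k + 1) n (cos x) - (sin x)\<^sup>2 * d = C * gegenbauer k (Suc n) (cos x)"
      unfolding d(2)[symmetric] sin_squared_eq ..
    finally show "(H has_vector_derivative C * (\<bar>sin x\<bar> powr (2 * k) * gegenbauer k (Suc n) (cos x))) (at x)"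
      unfolding has_real_derivative_iff_has_vector_derivative[symmetric] w by (simp add: mult_ac)
  qed auto
  from integral_unique[OF this] have "C * sin_integral k (\<lambda>x. gegenbauer k (Suc n) (cos x)) = 0"
    by (simp add: sin_integral_def H_def)
  then show ?thesis using C by simp
qed

text \<open>Splitting off the constant coefficient leaves a factor \<open>cos x\<close>, which the
  recurrence absorbs at the cost of moving \<open>n\<close> by one in either direction. The degree
  of \<open>p\<close> also drops by one, so the inequality survives; \<open>n\<close> has to be
  arbitrary.\<close>

lemma sin_integral_gegenbauer_poly:
  assumes "k > 0" "degree p < n"
  shows "sin_integral k (\<lambda>x. gegenbauer k n (cos x) * poly p (cos x)) = 0"
  using assms(2)
proof (induction p arbitrary: n)
  case 0
  then show ?case by (simp add: sin_integral_def)
next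
  case (pCons a p)
  then obtain m where n: "n = Suc m" by (cases n) auto
  show ?case
  proof (cases "p = 0")
    case True
    then show ?thesis using sin_integral_cmult[of k a "\<lambda>x. gegenbauer k n (cos x)"] sin_integral_gegenbauer[OF assms(1), of m]
      by (simp add: n mult.commute)
  next
    case False
    define N where "N = 2 * (real m + 1 + k)"
    have N: "N > 0" using assms(1) by (simp add: N_def)
    have d: "degree p < m" using pCons.prems n False by simp
    have t: "t * gegenbauer k n t = ((real m + 2) / N) * gegenbauer k (Suc (Suc m)) t + ((real m + 2 * k) / N) * gegenbauer k m t" for t
      unfolding n gegenbauer_mult_arg'[OF assms(1)] N_def[symmetric] by (simp add: add_divide_distrib algebra_simps)
    have e: "gegenbauer k n (cos x) * poly (pCons a p) (cos x) = a * gegenbauer k n (cos x) + 1 * (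
       ((real m + 2) / N) * (gegenbauer k (Suc (Suc m)) (cos x) * poly p (cos x)) +
       ((real m + 2 * k) / N) * (gegenbauer k m (cos x) * poly p (cos x)))" for x
    proof -
      have "gegenbauer k n (cos x) * poly (pCons a p) (cos x) = a * gegenbauer k n (cos x) + (cos x * gegenbauer k n (cos x)) * poly p (cos x)"
        by (simp add: algebra_simps)
      then show ?thesis unfolding t by (simp add: algebra_simps)
    qed
    have "sin_integral k (\<lambda>x. gegenbauer k n (cos x) * poly (pCons a p) (cos x)) =
      a * sin_integral k (\<lambda>x. gegenbauer k n (cos x)) + 1 * (
       ((real m + 2) / N) * sin_integral k (\<lambda>x. gegenbauer k (Suc (Suc m)) (cos x) * poly p (cos x)) +
       ((real m + 2 * k) / N) * sin_integral k (\<lambda>x. gegenbauer k m (cos x) * poly p (cos x)))"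
      unfolding e by (subst sin_integral_linear | intro continuous_intros assms | rule refl)+
    then show ?thesis
      using pCons.IH[OF d] pCons.IH[of "Suc (Suc m)"] d sin_integral_gegenbauer[OF assms(1), of m] by (simp add: n)
  qed
qed

text \<open>The abstract argument \<open>c x\<close> covers both Gegenbauer polynomials in
  \<open>t\<close> and \<open>cos (real n * x)\<close> as a polynomial in
  \<open>cos x\<close>.\<close>

lemma three_term_recurrence_poly:
  fixes f :: "nat \<Rightarrow> 'a \<Rightarrow> real"
  assumes "\<And>x. f 0 x = A" "\<And>x. f (Suc 0) x = B * c x"
    "\<And>n x. f (Suc (Suc n)) x = \<alpha> n * c x * f (Suc n) x + \<beta> n * f n x"
  shows "\<exists>p. degree p \<le> n \<and> (\<forall>x. f n x = poly p (c x))"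
proof (induction n rule: less_induct)
  case (less n)
  consider "n = 0" | "n = 1" | m where "n = Suc (Suc m)"
    by (metis One_nat_def not0_implies_Suc)
  then show ?case
  proof cases
    case 1
    then show ?thesis using assms(1) by (intro exI[of _ "[:A:]"]) auto
  next
    case 2
    then show ?thesis using assms(2) by (intro exI[of _ "[:0, B:]"]) auto
  next
    case 3
    obtain p where p: "degree p \<le> Suc m" "\<forall>x. f (Suc m) x = poly p (c x)" using less[of "Suc m"] 3 by auto
    obtain q where q: "degree q \<le> m" "\<forall>x. f m x = poly q (c x)" using less[of m] 3 by auto
    have "degree (smult (\<alpha> m) (pCons 0 p) + smult (\<beta> m) q) \<le> Suc (Suc m)"
      using p(1) q(1) by (intro degree_add_le) (auto intro: le_trans[OF degree_smult_le] le_trans[OF degree_pCons_le])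
    then show ?thesis
      using p(2) q(2) 3 assms(3) by (intro exI[of _ "smult (\<alpha> m) (pCons 0 p) + smult (\<beta> m) q"]) (simp add: mult_ac)
  qed
qed

lemma gegenbauer_poly: "\<exists>p. degree p \<le> n \<and> (\<forall>t. gegenbauer k n t = poly p t)"
  by (rule three_term_recurrence_poly[where \<alpha> = "\<lambda>n. 2 * (real n + 1 + k) / (real n + 2)"
        and \<beta> = "\<lambda>n. - ((real n + 2 * k) / (real n + 2))" and A = 1 and B = "2 * k"])
     (simp_all add: gegenbauer.simps(3) diff_divide_distrib)

lemma cos_mult_poly_cos: "\<exists>p. degree p \<le> n \<and> (\<forall>x::real. cos (real n * x) = poly p (cos x))"
proof (rule three_term_recurrence_poly[where \<alpha> = "\<lambda>n. 2" and \<beta> = "\<lambda>n. -1" and A = 1 and B = 1])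
  fix n :: nat and x :: real
  have "cos ((real n + 1) * x + x) + cos ((real n + 1) * x - x) = 2 * cos x * cos ((real n + 1) * x)"
    by (simp add: cos_add cos_diff)
  then show "cos (real (Suc (Suc n)) * x) = 2 * cos x * cos (real (Suc n) * x) + - 1 * cos (real n * x)"
    by (simp add: algebra_simps)
qed auto

text \<open>\<open>gegenbauer 1 n\<close> is the Chebyshev polynomial of the second kind, so
  \<open>gegenbauer_poly\<close> also bounds its degree.\<close>

lemma sin_Suc_mult: "sin (real (Suc n) * x) = sin x * gegenbauer 1 n (cos x)"
proof (induction n rule: less_induct)
  case (less n)
  consider "n = 0" | "n = 1" | m where "n = Suc (Suc m)"
    by (metis One_nat_def not0_implies_Suc)
  then show ?case
  proof cases
    case 3
    have g: "gegenbauer 1 n (cos x) = 2 * cos x * gegenbauer 1 (Suc m) (cos x) - gegenbauer 1 m (cos x)"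
      unfolding 3 gegenbauer.simps(3) by (simp add: divide_simps) (simp add: algebra_simps)
    have "sin ((real m + 2) * x + x) + sin ((real m + 2) * x - x) = 2 * cos x * sin ((real m + 2) * x)"
      by (simp add: sin_add sin_diff)
    then have "sin (real (Suc n) * x) = 2 * cos x * sin (real (Suc (Suc m)) * x) - sin (real (Suc m) * x)"
      by (simp add: 3 algebra_simps)
    then show ?thesis unfolding g using less[of m] less[of "Suc m"] 3 by (simp add: algebra_simps)
  qed (simp_all add: sin_double)
qed

lemma sin_mult_poly_cos: "\<exists>p. degree p \<le> n \<and> (\<forall>x::real. sin (real (Suc n) * x) = sin x * poly p (cos x))"
  using gegenbauer_poly[of n 1] sin_Suc_mult by metis

lemma sin_integral_gegenbauer_orth:
  assumes "k > 0" "m < n"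
  shows "sin_integral k (\<lambda>x. gegenbauer k n (cos x) * gegenbauer k m (cos x)) = 0"
proof -
  obtain p where p: "degree p \<le> m" "\<forall>t. gegenbauer k m t = poly p t" using gegenbauer_poly by blast
  then show ?thesis using sin_integral_gegenbauer_poly[of k p n] assms by simp
qed

section \<open>Norms of Gegenbauer polynomials\<close>

definition gegenbauer_norm2 :: "real \<Rightarrow> nat \<Rightarrow> real" where
  "gegenbauer_norm2 k n = sin_integral k (\<lambda>x. (gegenbauer k n (cos x))\<^sup>2)"

text \<open>The integral \<open>I\<close> of \<open>cos x\<close> against two neighbours is
  evaluated twice, with the recurrence applied once to the higher and once to the lower polynomial;
  orthogonality leaves a single norm each time.\<close>

lemma gegenbauer_norm2_Suc:
  assumes "k > 0"
  shows "(real n + 1) * (real n + 1 + k) * gegenbauer_norm2 k (Suc n) = (real n + k) * (real n + 2 * k) * gegenbauer_norm2 k n"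
proof -
  let ?G = "\<lambda>n x. gegenbauer k n (cos x)"
  define I where "I = sin_integral k (\<lambda>x. cos x * ?G n x * ?G (Suc n) x)"
  have "2 * (real n + 1 + k) * I = sin_integral k (\<lambda>x. (2 * (real n + 1 + k) * cos x * ?G (Suc n) x) * ?G n x)"
    unfolding I_def sin_integral_cmult[symmetric] by (simp add: mult_ac)
  also have "\<dots> = sin_integral k (\<lambda>x. (real n + 2) * (?G (Suc (Suc n)) x * ?G n x) + (real n + 2 * k) * (?G n x)\<^sup>2)"
    unfolding gegenbauer_mult_arg by (simp add: algebra_simps power2_eq_square)
  also have "\<dots> = (real n + 2 * k) * gegenbauer_norm2 k n"
    by (subst sin_integral_linear)
       (intro assms continuous_intros | simp add: gegenbauer_norm2_def sin_integral_gegenbauer_orth assms)+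
  finally have 1: "2 * (real n + 1 + k) * I = (real n + 2 * k) * gegenbauer_norm2 k n" .
  have 2: "(real n + 1) * gegenbauer_norm2 k (Suc n) = 2 * (real n + k) * I"
  proof (cases n)
    case 0
    then show ?thesis
      by (simp add: gegenbauer_norm2_def I_def sin_integral_cmult[symmetric] power2_eq_square mult_ac)
  next
    case (Suc m)
    have "(real n + 1) * gegenbauer_norm2 k (Suc n) = sin_integral k (\<lambda>x. ((real n + 1) * ?G (Suc n) x) * ?G (Suc n) x)"
      by (simp add: gegenbauer_norm2_def sin_integral_cmult[symmetric] power2_eq_square mult_ac)
    also have "\<dots> = sin_integral k (\<lambda>x. 2 * (real n + k) * (cos x * ?G n x * ?G (Suc n) x) + (- (real m + 2 * k)) * (?G (Suc n) x * ?G m x))"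
    proof -
      have e: "(real n + 1) * ?G (Suc n) x = 2 * (real n + k) * cos x * ?G n x - (real m + 2 * k) * ?G m x" for x
        using gegenbauer_mult_arg[of m k "cos x"] Suc by (simp add: algebra_simps)
      show ?thesis unfolding e by (simp add: algebra_simps)
    qed
    also have "\<dots> = 2 * (real n + k) * I"
      by (subst sin_integral_linear)
         (intro assms continuous_intros | simp add: I_def sin_integral_gegenbauer_orth assms Suc)+
    finally show ?thesis .
  qed
  show ?thesis using 1 2 by algebra
qed

text \<open>The recurrences for the norm and for the value at \<open>1\<close> are matched; the
  start value is where \<open>sin_mass_jacobi_mass\<close> brings in \<open>2 * pi\<close>.\<close>

lemma gegenbauer_norm2_eq:
  assumes "k > 0"
  shows "gegenbauer_norm2 k n = 2 * pi * gegenbauer k n 1 / ((real n + k) * jacobi_mass k)"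
proof (induction n)
  case 0
  then show ?case using sin_mass_jacobi_mass[OF assms] jacobi_mass_pos[OF assms] assms
    by (simp add: gegenbauer_norm2_def sin_integral_def field_simps)
next
  case (Suc n)
  have p: "jacobi_mass k > 0" "real n + k > 0" "real n + 1 + k > 0" "real n + 1 > 0"
    using assms jacobi_mass_pos by auto
  have g: "gegenbauer k (Suc n) 1 = (real n + 2 * k) * gegenbauer k n 1 / (real n + 1)"
    using gegenbauer_one_Suc[of n k] by (simp add: field_simps)
  have "gegenbauer_norm2 k (Suc n) = (real n + k) * (real n + 2 * k) * gegenbauer_norm2 k n / ((real n + 1) * (real n + 1 + k))"
    using gegenbauer_norm2_Suc[OF assms, of n] p by (simp add: nonzero_eq_divide_eq mult_ac)
  then show ?case unfolding Suc g using p by (simp add: divide_simps) (simp add: algebra_simps)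
qed

lemma gegenbauer_norm2_pos: "k > 0 \<Longrightarrow> gegenbauer_norm2 k n > 0"
  by (simp add: gegenbauer_norm2_eq gegenbauer_one_pos jacobi_mass_pos add_nonneg_pos)

lemma sin_integral_gegenbauer_cos:
  assumes "k > 0" "\<bar>j\<bar> < int n"
  shows "sin_integral k (\<lambda>x. gegenbauer k n (cos x) * cos (of_int j * x)) = 0"
proof -
  obtain p where p: "degree p \<le> nat \<bar>j\<bar>" "\<forall>x::real. cos (real (nat \<bar>j\<bar>) * x) = poly p (cos x)"
    using cos_mult_poly_cos by blast
  have "cos (of_int j * x) = poly p (cos x)" for x :: real
    using p(2)[rule_format, of x] by (cases "j \<ge> 0") auto
  then show ?thesis using sin_integral_gegenbauer_poly[of k p n] assms p(1) by simp
qed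

text \<open>Both sines contribute a factor \<open>sin x\<close>, which raises the weight to
  \<open>k + 1\<close>; the remaining polynomial has degree at most
  \<open>\<bar>j\<bar> - 1\<close>, hence the bound is not strict, unlike in the cosine
  case.\<close>

lemma sin_integral_gegenbauer_sin:
  assumes "k > 0" "\<bar>j\<bar> \<le> int n"
  shows "sin_integral k (\<lambda>x. (sin x * gegenbauer (k + 1) n (cos x)) * sin (of_int j * x)) = 0"
proof (cases "j = 0")
  case True
  then show ?thesis by (simp add: sin_integral_def)
next
  case False
  define i where "i = nat (\<bar>j\<bar> - 1)"
  have i: "int (Suc i) = \<bar>j\<bar>" "i < n" using False assms(2) by (auto simp: i_def)
  obtain p where p: "degree p \<le> i" "\<forall>x::real. sin (real (Suc i) * x) = sin x * poly p (cos x)"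
    using sin_mult_poly_cos by blast
  have "real (Suc i) = of_int \<bar>j\<bar>" using i(1) by (metis of_int_of_nat_eq)
  then have s: "sin (of_int j * x) = of_int (sgn j) * (sin x * poly p (cos x))" for x :: real
    using p(2)[rule_format, of x] False by (cases "j > 0") (auto simp: abs_if split: if_splits)
  have "sin_integral k (\<lambda>x. (sin x * gegenbauer (k + 1) n (cos x)) * sin (of_int j * x)) =
     of_int (sgn j) * sin_integral k (\<lambda>x. (sin x)\<^sup>2 * (gegenbauer (k + 1) n (cos x) * poly p (cos x)))"
    unfolding s sin_integral_cmult[symmetric] by (simp add: power2_eq_square mult_ac)
  also have "\<dots> = 0"
    using sin_integral_gegenbauer_poly[of "k + 1" p n] assms(1) p(1) i(2) by (simp add: sin_integral_sin_square)
  finally show ?thesis .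
qed

section \<open>Trigonometric polynomials and uniqueness\<close>

lemma exp_int_cis:
  "exp (of_int j * (\<i> * of_real x)) = cis (of_int j * x)"
  "exp (\<i> * of_int j * of_real x) = cis (of_int j * x)"
  by (simp_all add: cis_conv_exp mult_ac)

lemma HO_E_minus_arg: "HO_E k m (- (\<i> * of_real y)) = HO_E k m (\<i> * of_real (- y))"
  by simp

lemma finite_tri [simp]: "finite {j. tri j n}"
  by (rule finite_subset[of _ "{- \<bar>n\<bar>..\<bar>n\<bar>}"]) (auto simp: tri_def)

lemma tri_of_nat: "tri j (int m) \<longleftrightarrow> \<bar>j\<bar> < int m \<and> even (int m - \<bar>j\<bar>)"
  by (auto simp: tri_def)

lemma tri_of_natI: "\<bar>j\<bar> < int m \<Longrightarrow> even (int m - j) \<Longrightarrow> tri j (int m)"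
  unfolding tri_of_nat by presburger

text \<open>The additional index is the one extra orthogonality condition that separates the
  polynomial of index \<open>-m\<close> from the plane it shares with index
  \<open>m\<close>.\<close>

lemma tri_uminus_of_nat: "tri j (- int (Suc n)) \<longleftrightarrow> tri j (int (Suc n)) \<or> j = int (Suc n)"
  by (auto simp: tri_def)

lemma ip_k_integrable:
  assumes "k > 0" "continuous_on UNIV f" "continuous_on UNIV g"
  shows "(\<lambda>x. f x * cnj (g x) * of_real (\<bar>sin x\<bar> powr (2 * k))) integrable_on {-pi..pi}"
  by (intro integrable_continuous_interval continuous_intros continuous_on_sin_weight
        continuous_on_subset[OF assms(2)] continuous_on_subset[OF assms(3)] assms(1)) auto

lemma ip_k_add_right:
  assumes "k > 0" "continuous_on UNIV f" "continuous_on UNIV g" "continuous_on UNIV h"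
  shows "ip_k k f (\<lambda>x. g x + h x) = ip_k k f g + ip_k k f h"
proof -
  have "ip_k k f (\<lambda>x. g x + h x) = integral {-pi..pi} (\<lambda>x. f x * cnj (g x) * of_real (\<bar>sin x\<bar> powr (2 * k))
     + f x * cnj (h x) * of_real (\<bar>sin x\<bar> powr (2 * k)))"
    unfolding ip_k_def by (simp add: algebra_simps)
  also have "\<dots> = ip_k k f g + ip_k k f h"
    unfolding ip_k_def by (intro integral_add ip_k_integrable assms)
  finally show ?thesis .
qed

lemma ip_k_diff_left:
  assumes "k > 0" "continuous_on UNIV f" "continuous_on UNIV g" "continuous_on UNIV h"
  shows "ip_k k (\<lambda>x. f x - g x) h = ip_k k f h - ip_k k g h"
proof -
  have "ip_k k (\<lambda>x. f x - g x) h = integral {-pi..pi} (\<lambda>x. f x * cnj (h x) * of_real (\<bar>sin x\<bar> powr (2 * k))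
     - g x * cnj (h x) * of_real (\<bar>sin x\<bar> powr (2 * k)))"
    unfolding ip_k_def by (simp add: algebra_simps)
  also have "\<dots> = ip_k k f h - ip_k k g h"
    unfolding ip_k_def by (intro integral_diff ip_k_integrable assms)
  finally show ?thesis .
qed

lemma ip_k_sum_right:
  assumes "k > 0" "continuous_on UNIV f" "\<And>j. continuous_on UNIV (g j)" "finite S"
  shows "ip_k k f (\<lambda>x. \<Sum>j\<in>S. c j * g j x) = (\<Sum>j\<in>S. cnj (c j) * ip_k k f (g j))"
proof -
  have "ip_k k f (\<lambda>x. \<Sum>j\<in>S. c j * g j x) =
      integral {-pi..pi} (\<lambda>x. \<Sum>j\<in>S. cnj (c j) * (f x * cnj (g j x) * of_real (\<bar>sin x\<bar> powr (2 * k))))"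
    unfolding ip_k_def by (simp add: sum_distrib_left sum_distrib_right mult_ac)
  also have "\<dots> = (\<Sum>j\<in>S. cnj (c j) * ip_k k f (g j))"
    unfolding ip_k_def using assms
    by (subst integral_sum) (auto intro!: integrable_on_mult_right ip_k_integrable)
  finally show ?thesis .
qed

text \<open>A continuous nonnegative function with integral zero vanishes; the weight can be divided
  out only away from the zeros of \<open>sin\<close>.\<close>

lemma ip_k_self_eq_0:
  assumes "k > 0" "continuous_on UNIV f" "ip_k k f f = 0" "x \<in> {-pi..pi}" "sin x \<noteq> 0"
  shows "f x = 0"
proof -
  define h where "h x = (cmod (f x))\<^sup>2 * \<bar>sin x\<bar> powr (2 * k)" for x
  have ch: "continuous_on {-pi..pi} h"
    unfolding h_def
    by (intro continuous_intros continuous_on_sin_weight continuous_on_subset[OF assms(2)] assms(1)) auto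
  have e: "f x * cnj (f x) * of_real (\<bar>sin x\<bar> powr (2 * k)) = complex_of_real (h x)" for x
    unfolding h_def complex_norm_square[symmetric] by simp
  have "((\<lambda>x. complex_of_real (h x)) has_integral of_real (integral {-pi..pi} h)) {-pi..pi}"
    using ch by (intro has_integral_of_real integrable_integral) (auto intro: integrable_continuous_interval)
  then have "complex_of_real (integral {-pi..pi} h) = 0"
    using assms(3) unfolding ip_k_def e by (simp add: integral_unique)
  then have "integral {-pi..pi} h = 0" by simp
  then have "h x = 0"
    using integral_eq_0_iff[OF ch] assms(4) by (simp add: h_def)
  then show ?thesis using assms(5) by (simp add: h_def)
qed

lemma integral_cis_int:
  "integral {-pi..pi} (\<lambda>x. cis (of_int m * x)) = (if m = 0 then 2 * of_real pi else 0)"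
proof (cases "m = 0")
  case True
  then show ?thesis by (simp add: scaleR_conv_of_real)
next
  case False
  have "((\<lambda>x. cis (of_int m * x)) has_integral
      (cis (of_int m * pi) / (\<i> * of_int m) - cis (of_int m * (-pi)) / (\<i> * of_int m))) {-pi..pi}"
  proof (rule fundamental_theorem_of_calculus)
    fix x assume "x \<in> {-pi..pi}"
    show "((\<lambda>x. cis (of_int m * x) / (\<i> * of_int m)) has_vector_derivative cis (of_int m * x)) (at x within {-pi..pi})"
      unfolding cis_conv_exp
      by (rule has_vector_derivative_real_field derivative_eq_intros refl | use False in \<open>simp add: field_simps\<close>)+
  qed simp
  moreover have "cis (of_int m * pi) = cis (of_int m * (-pi))"
    by (simp add: complex_eq_iff sin_int_times_real mult.commute)
  ultimately show ?thesis using False by (simp add: integral_unique)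
qed

lemma trig_sum_eq_0_imp_coeff_eq_0:
  assumes "finite S" "\<And>x. x \<in> {-pi..pi} \<Longrightarrow> sin x \<noteq> 0 \<Longrightarrow> (\<Sum>j\<in>S. c j * cis (of_int j * x)) = 0" "l \<in> S"
  shows "c l = 0"
proof -
  have "0 = integral {-pi..pi} (\<lambda>x. (\<Sum>j\<in>S. c j * cis (of_int j * x)) * cis (- of_int l * x))"
  proof -
    have "integral {-pi..pi} (\<lambda>x. (\<Sum>j\<in>S. c j * cis (of_int j * x)) * cis (- of_int l * x)) = integral {-pi..pi} (\<lambda>_. 0)"
    \<comment> \<open>The zeros of \<open>sin\<close> in the interval form a finite set, which the
      integral does not see.\<close>
    proof (rule integral_spike[of "{-pi, 0, pi}"])
      fix x assume x: "x \<in> {-pi..pi} - {-pi, 0, pi}"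
      then have "sin x \<noteq> 0" using sin_eq_0_pi[of x] by auto
      then show "0 = (\<Sum>j\<in>S. c j * cis (of_int j * x)) * cis (- of_int l * x)" using assms(2)[of x] x by simp
    qed simp
    then show ?thesis by simp
  qed
  also have "\<dots> = integral {-pi..pi} (\<lambda>x. \<Sum>j\<in>S. c j * cis (of_int (j - l) * x))"
  proof -
    have "(\<Sum>j\<in>S. c j * cis (of_int j * x)) * cis (- of_int l * x) = (\<Sum>j\<in>S. c j * cis (of_int (j - l) * x))" for x
      unfolding sum_distrib_right mult.assoc cis_mult by (simp add: algebra_simps)
    then show ?thesis by simp
  qed
  also have "\<dots> = (\<Sum>j\<in>S. c j * integral {-pi..pi} (\<lambda>x. cis (of_int (j - l) * x)))"
    using assms(1) by (subst integral_sum) (auto intro!: integrable_continuous_interval continuous_intros)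
  also have "\<dots> = (\<Sum>j\<in>S. if j = l then c j * (2 * of_real pi) else 0)"
    unfolding integral_cis_int by (intro sum.cong) auto
  also have "\<dots> = c l * (2 * of_real pi)" using assms by simp
  finally show ?thesis by simp
qed

text \<open>Turns the definite description into a checkable criterion. The difference of two
  candidates lies in the span of the lower exponentials and is orthogonal to it, so it has norm zero
  and all its coefficients vanish.\<close>

lemma HO_E_eqI:
  assumes "k > 0"
    and f: "\<And>x. f x = cis (of_int n * x) + (\<Sum>j | tri j n. c j * cis (of_int j * x))"
    and orth: "\<And>j. tri j n \<Longrightarrow> ip_k k f (\<lambda>x. cis (of_int j * x)) = 0"
  shows "HO_E k n (\<i> * of_real x) = f x"
proof -
  define P where "P c \<longleftrightarrow> (\<forall>j. \<not> tri j n \<longrightarrow> c j = 0) \<and> (\<forall>j. tri j n \<longrightarrow>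
       ip_k k (\<lambda>x. Eform n c (\<i> * of_real x)) (\<lambda>x. exp (\<i> * of_int j * of_real x)) = 0)" for c
  have Ef: "Eform n c (\<i> * of_real x) = cis (of_int n * x) + (\<Sum>j | tri j n. c j * cis (of_int j * x))" for c x
    unfolding Eform_def exp_int_cis ..
  \<comment> \<open>The coefficients \<open>c\<close> are arbitrary off the lower set, whereas the
    description in \<open>HO_E\<close> requires zeros there.\<close>
  define c' where "c' j = (if tri j n then c j else 0)" for j
  have f': "Eform n c' (\<i> * of_real x) = f x" for x
    unfolding Ef f by (simp add: c'_def)
  have Pc': "P c'"
    unfolding P_def f' exp_int_cis using orth by (auto simp: c'_def)
  have cf: "continuous_on UNIV f" unfolding f[abs_def] by (intro continuous_intros)
  have unique: "d = c'" if "P d" for d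
  proof -
    define g where "g x = (\<Sum>j | tri j n. (d j - c' j) * cis (of_int j * x))" for x
    have g: "g x = Eform n d (\<i> * of_real x) - f x" for x
      unfolding g_def f'[symmetric] Ef by (simp add: algebra_simps sum_subtractf)
    have cg: "continuous_on UNIV g" unfolding g_def by (intro continuous_intros)
    have cE: "continuous_on UNIV (\<lambda>x. Eform n d (\<i> * of_real x))" unfolding Ef by (intro continuous_intros)
    have "ip_k k g (\<lambda>x. cis (of_int j * x)) = 0" if "tri j n" for j
    proof -
      have "ip_k k g (\<lambda>x. cis (of_int j * x)) = ip_k k (\<lambda>x. Eform n d (\<i> * of_real x)) (\<lambda>x. cis (of_int j * x)) - ip_k k f (\<lambda>x. cis (of_int j * x))"
        unfolding g by (intro ip_k_diff_left assms cE cf continuous_intros)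
      then show ?thesis using orth[OF that] \<open>P d\<close> that unfolding P_def exp_int_cis by simp
    qed
    moreover have "ip_k k g g = (\<Sum>j | tri j n. cnj (d j - c' j) * ip_k k g (\<lambda>x. cis (of_int j * x)))"
      unfolding g_def[abs_def] by (rule ip_k_sum_right) (auto intro!: assms continuous_intros)
    ultimately have "ip_k k g g = 0" by simp
    then have g0: "g x = 0" if "x \<in> {-pi..pi}" "sin x \<noteq> 0" for x
      using ip_k_self_eq_0[OF assms(1) cg] that by blast
    have "d j - c' j = 0" if "tri j n" for j
      by (rule trig_sum_eq_0_imp_coeff_eq_0[where S = "{j. tri j n}" and c = "\<lambda>j. d j - c' j"])
         (use that g0 in \<open>auto simp: g_def\<close>)
    moreover have "d j = c' j" if "\<not> tri j n" for j
      using \<open>P d\<close> that by (simp add: P_def c'_def)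
    ultimately show ?thesis by (intro ext) (metis eq_iff_diff_eq_0)
  qed
  have "(THE c. P c) = c'" by (rule the_equality, rule Pc', rule unique)
  then have "HO_E k n = Eform n c'" unfolding HO_E_def P_def by simp
  then show ?thesis by (simp add: f')
qed

text \<open>The space of lower-order terms common to the indices \<open>m\<close> and
  \<open>-m\<close>; leading terms can then be compared without naming the remaining
  coefficients.\<close>

definition trig_below :: "nat \<Rightarrow> (real \<Rightarrow> complex) \<Rightarrow> bool" where
  "trig_below m f \<longleftrightarrow> (\<exists>c. \<forall>x. f x = (\<Sum>j | tri j (int m). c j * cis (of_int j * x)))"

lemma trig_below_cis: "tri j (int m) \<Longrightarrow> trig_below m (\<lambda>x. a * cis (of_int j * x))"
  unfolding trig_below_def
  by (rule exI[of _ "\<lambda>i. if i = j then a else 0"]) (simp add: if_distrib[of "\<lambda>y. y * _"] cong: if_cong)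

lemma trig_below_add: "trig_below m f \<Longrightarrow> trig_below m g \<Longrightarrow> trig_below m (\<lambda>x. f x + g x)"
  unfolding trig_below_def
proof safe
  fix c d assume "\<forall>x. f x = (\<Sum>j | tri j (int m). c j * cis (of_int j * x))" "\<forall>x. g x = (\<Sum>j | tri j (int m). d j * cis (of_int j * x))"
  then show "\<exists>c. \<forall>x. f x + g x = (\<Sum>j | tri j (int m). c j * cis (of_int j * x))"
    by (intro exI[of _ "\<lambda>j. c j + d j"]) (simp add: algebra_simps sum.distrib)
qed

lemma trig_below_cmult: "trig_below m f \<Longrightarrow> trig_below m (\<lambda>x. a * f x)"
  unfolding trig_below_def
proof safe
  fix c assume "\<forall>x. f x = (\<Sum>j | tri j (int m). c j * cis (of_int j * x))"
  then show "\<exists>c. \<forall>x. a * f x = (\<Sum>j | tri j (int m). c j * cis (of_int j * x))"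
    by (intro exI[of _ "\<lambda>j. a * c j"]) (simp add: sum_distrib_left mult_ac)
qed

lemma trig_below_sum: "(\<And>i. i \<in> S \<Longrightarrow> trig_below m (f i)) \<Longrightarrow> trig_below m (\<lambda>x. \<Sum>i\<in>S. f i x)"
proof (induction S rule: infinite_finite_induct)
  case (insert i S)
  then show ?case by (simp add: trig_below_add)
qed (auto simp: trig_below_def intro: exI[of _ "\<lambda>_. 0"])

lemma continuous_on_trig_below: "trig_below m f \<Longrightarrow> continuous_on S f"
  unfolding trig_below_def by (auto simp: fun_eq_iff[symmetric] intro!: continuous_intros)

lemma trig_below_symmetric_sum:
  "trig_below (Suc n) (\<lambda>x. \<Sum>i<n. g i * cis (of_int (int n - 1 - 2 * int i) * x))"
proof (intro trig_below_sum trig_below_cis)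
  fix i assume "i \<in> {..<n}"
  then show "tri (int n - 1 - 2 * int i) (int (Suc n))" by (intro tri_of_natI) auto
qed

text \<open>The first and last terms of \<open>gegenbauer_explicit\<close> carry the top frequencies
  with equal coefficients; the inner frequencies descend in steps of two.\<close>

lemma even_part_leading:
  "trig_below (Suc n) (\<lambda>x. of_real (gegenbauer k (Suc n) (cos x)) -
     of_real (pochhammer k (Suc n) / fact (Suc n)) * (cis (of_int (int (Suc n)) * x) + cis (of_int (- int (Suc n)) * x)))"
proof -
  define g where "g j = complex_of_real (pochhammer k j / fact j * (pochhammer k (Suc n - j) / fact (Suc n - j)))" for j
  have "of_real (gegenbauer k (Suc n) (cos x)) - of_real (pochhammer k (Suc n) / fact (Suc n)) *
       (cis (of_int (int (Suc n)) * x) + cis (of_int (- int (Suc n)) * x)) =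
     (\<Sum>i<n. g (Suc i) * cis (of_int (int n - 1 - 2 * int i) * x))" for x
  proof -
    have "complex_of_real (gegenbauer k (Suc n) (cos x)) = (\<Sum>j\<le>Suc n. g j * cis ((real (Suc n) - 2 * real j) * x))"
      unfolding gegenbauer_explicit g_def ..
    also have "\<dots> = g 0 * cis (real (Suc n) * x) + (\<Sum>i<n. g (Suc i) * cis ((real (Suc n) - 2 * real (Suc i)) * x))
        + g (Suc n) * cis ((real (Suc n) - 2 * real (Suc n)) * x)"
      by (simp only: sum.atMost_Suc sum.atMost_shift) (simp only: of_nat_0 mult_zero_right diff_zero sum.lessThan_Suc add.assoc)
    finally show ?thesis by (simp add: g_def algebra_simps)
  qed
  moreover have "trig_below (Suc n) (\<lambda>x. \<Sum>i<n. g (Suc i) * cis (of_int (int n - 1 - 2 * int i) * x))"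
    by (rule trig_below_symmetric_sum)
  ultimately show ?thesis by (simp only:)
qed

text \<open>Multiplication by \<open>2 * \<i> * sin x = cis x - cis (- x)\<close> gives two shifted
  copies of the Fourier sum; the upper top frequency survives in one, the lower in the
  other.\<close>

lemma odd_part_leading:
  "trig_below (Suc n) (\<lambda>x. 2 * \<i> * of_real (sin x * gegenbauer k n (cos x)) -
     of_real (pochhammer k n / fact n) * (cis (of_int (int (Suc n)) * x) - cis (of_int (- int (Suc n)) * x)))"
proof -
  define g where "g j = complex_of_real (pochhammer k j / fact j * (pochhammer k (n - j) / fact (n - j)))" for j
  have s: "2 * \<i> * of_real (sin x) = cis x - cis (- x)" for x by (simp add: complex_eq_iff)
  have "2 * \<i> * of_real (sin x * gegenbauer k n (cos x)) -
     of_real (pochhammer k n / fact n) * (cis (of_int (int (Suc n)) * x) - cis (of_int (- int (Suc n)) * x)) =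
     (\<Sum>i<n. g (Suc i) * cis (of_int (int n - 1 - 2 * int i) * x)) + (-1) * (\<Sum>i<n. g i * cis (of_int (int n - 1 - 2 * int i) * x))" for x
  proof -
    have "2 * \<i> * of_real (sin x * gegenbauer k n (cos x)) = (cis x - cis (- x)) * (\<Sum>j\<le>n. g j * cis ((real n - 2 * real j) * x))"
      unfolding s[symmetric] g_def using gegenbauer_explicit[of k n x] by simp
    also have "\<dots> = (\<Sum>j\<le>n. g j * cis ((real n + 1 - 2 * real j) * x)) - (\<Sum>j\<le>n. g j * cis ((real n - 1 - 2 * real j) * x))"
    proof -
      have 1: "cis x * (g j * cis ((real n - 2 * real j) * x)) = g j * cis ((real n + 1 - 2 * real j) * x)" for j
        unfolding mult.left_commute[of "cis x"] cis_mult by (simp add: algebra_simps)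
      have 2: "cis (- x) * (g j * cis ((real n - 2 * real j) * x)) = g j * cis ((real n - 1 - 2 * real j) * x)" for j
        unfolding mult.left_commute[of "cis (- x)"] cis_mult by (simp add: algebra_simps)
      show ?thesis unfolding left_diff_distrib[of "cis x"] sum_distrib_left 1 2 sum_subtractf ..
    qed
    also have "(\<Sum>j\<le>n. g j * cis ((real n + 1 - 2 * real j) * x)) =
        g 0 * cis ((real n + 1) * x) + (\<Sum>i<n. g (Suc i) * cis ((real n + 1 - 2 * real (Suc i)) * x))"
      by (simp only: sum.atMost_shift) simp
    also have "(\<Sum>j\<le>n. g j * cis ((real n - 1 - 2 * real j) * x)) =
        (\<Sum>i<n. g i * cis ((real n - 1 - 2 * real i) * x)) + g n * cis ((real n - 1 - 2 * real n) * x)"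
      by (simp flip: lessThan_Suc_atMost)
    finally show ?thesis by (simp add: g_def algebra_simps)
  qed
  moreover have "trig_below (Suc n) (\<lambda>x. (\<Sum>i<n. g (Suc i) * cis (of_int (int n - 1 - 2 * int i) * x)) + (-1) * (\<Sum>i<n. g i * cis (of_int (int n - 1 - 2 * int i) * x)))"
    by (rule trig_below_add[OF trig_below_symmetric_sum trig_below_cmult[OF trig_below_symmetric_sum]])
  ultimately show ?thesis by (simp only:)
qed

section \<open>Explicit Heckman--Opdam polynomials\<close>

text \<open>Of the four real integrals two vanish by parity: even times sine and odd times
  cosine.\<close>

lemma ip_k_combination:
  fixes A B :: "real \<Rightarrow> real"
  assumes "k > 0" "continuous_on UNIV A" "continuous_on UNIV B"
    "\<And>x. A (- x) = A x" "\<And>x. B (- x) = - B x"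
  shows "ip_k k (\<lambda>x. \<alpha> * of_real (A x) + \<beta> * of_real (B x)) (\<lambda>x. cis (of_int j * x)) =
    \<alpha> * of_real (sin_integral k (\<lambda>x. A x * cos (of_int j * x))) - \<i> * \<beta> * of_real (sin_integral k (\<lambda>x. B x * sin (of_int j * x)))"
proof -
  have I: "((\<lambda>x. complex_of_real (\<bar>sin x\<bar> powr (2 * k) * f x)) has_integral of_real (sin_integral k f)) {-pi..pi}"
    if "continuous_on UNIV f" for f
    unfolding sin_integral_def
    by (intro has_integral_of_real integrable_integral sin_weight_integrable assms(1) continuous_on_subset[OF that]) auto
  have c: "continuous_on UNIV (\<lambda>x. A x * cos (of_int j * x))" "continuous_on UNIV (\<lambda>x. A x * sin (of_int j * x))"
    "continuous_on UNIV (\<lambda>x. B x * cos (of_int j * x))" "continuous_on UNIV (\<lambda>x. B x * sin (of_int j * x))"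
    by (intro continuous_intros assms)+
  have z: "sin_integral k (\<lambda>x. A x * sin (of_int j * x)) = 0" "sin_integral k (\<lambda>x. B x * cos (of_int j * x)) = 0"
    by (rule sin_integral_odd; simp add: assms)+
  have "((\<lambda>x. \<alpha> * complex_of_real (\<bar>sin x\<bar> powr (2 * k) * (A x * cos (of_int j * x)))
       - \<i> * \<alpha> * complex_of_real (\<bar>sin x\<bar> powr (2 * k) * (A x * sin (of_int j * x)))
       + (\<beta> * complex_of_real (\<bar>sin x\<bar> powr (2 * k) * (B x * cos (of_int j * x)))
       - \<i> * \<beta> * complex_of_real (\<bar>sin x\<bar> powr (2 * k) * (B x * sin (of_int j * x))))) has_integral
     (\<alpha> * of_real (sin_integral k (\<lambda>x. A x * cos (of_int j * x))) - \<i> * \<alpha> * of_real (sin_integral k (\<lambda>x. A x * sin (of_int j * x)))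
      + (\<beta> * of_real (sin_integral k (\<lambda>x. B x * cos (of_int j * x))) - \<i> * \<beta> * of_real (sin_integral k (\<lambda>x. B x * sin (of_int j * x)))))) {-pi..pi}"
    by (intro has_integral_add has_integral_diff has_integral_mult_right I c)
  moreover have "(\<alpha> * complex_of_real (\<bar>sin x\<bar> powr (2 * k) * (A x * cos (of_int j * x)))
       - \<i> * \<alpha> * complex_of_real (\<bar>sin x\<bar> powr (2 * k) * (A x * sin (of_int j * x)))
       + (\<beta> * complex_of_real (\<bar>sin x\<bar> powr (2 * k) * (B x * cos (of_int j * x)))
       - \<i> * \<beta> * complex_of_real (\<bar>sin x\<bar> powr (2 * k) * (B x * sin (of_int j * x))))) =
     (\<alpha> * of_real (A x) + \<beta> * of_real (B x)) * cnj (cis (of_int j * x)) * of_real (\<bar>sin x\<bar> powr (2 * k))" for x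
  proof -
    have e: "cnj (cis (of_int j * x)) = of_real (cos (of_int j * x)) - \<i> * of_real (sin (of_int j * x))"
      by (simp add: complex_eq_iff)
    show ?thesis unfolding e of_real_mult by algebra
  qed
  ultimately show ?thesis unfolding ip_k_def z by (simp add: integral_unique)
qed

text \<open>
  Level \<open>m = Suc n\<close>: the even function \<open>A\<close> and the odd function \<open>B\<close> have top frequency \<open>m\<close> and are
  orthogonal to all \<open>cis (j x)\<close> with \<open>j\<close> below \<open>m\<close>. Matching the coefficients of \<open>cis (\<plusminus> m x)\<close> gives
  \<open>E\<^sub>m = u A + \<i> v B\<close>, and orthogonality to \<open>E\<^sub>m\<close> makes \<open>E\<^sub>-\<^sub>m\<close> a multiple of
  \<open>hB v A - \<i> hA u B\<close>.
\<close>

locale ho_level =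
  fixes k :: real and n :: nat
  assumes k: "k > 0"
begin

definition A :: "real \<Rightarrow> real" where "A x = gegenbauer k (Suc n) (cos x)"
definition B :: "real \<Rightarrow> real" where "B x = sin x * gegenbauer (k + 1) n (cos x)"
definition a :: real where "a = pochhammer k (Suc n) / fact (Suc n)"
definition b :: real where "b = pochhammer (k + 1) n / fact n"
definition hA :: real where "hA = gegenbauer_norm2 k (Suc n)"
definition hB :: real where "hB = gegenbauer_norm2 (k + 1) n"
text \<open>With these scalings \<open>u A\<close> has coefficient 1/2 at both top frequencies,
  while \<open>\<i> v B\<close> has 1/2 and -1/2, so their sum has leading coefficient 1 and no term
  at the opposite frequency. \<open>N\<close> turns out to be its squared norm.\<close>

definition u :: real where "u = 1 / (2 * a)"
definition v :: real where "v = 1 / b"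
definition N :: real where "N = u\<^sup>2 * hA + v\<^sup>2 * hB"
definition cs :: "real \<Rightarrow> real" where "cs x = cos (of_int (int (Suc n)) * x)"
definition sn :: "real \<Rightarrow> real" where "sn x = sin (of_int (int (Suc n)) * x)"

lemma cont: "continuous_on S A" "continuous_on S B"
  unfolding A_def B_def by (intro continuous_intros)+

lemma parity: "A (- x) = A x" "B (- x) = - B x"
  by (simp_all add: A_def B_def)

lemma pos: "a > 0" "b > 0" "hA > 0" "hB > 0" "u > 0" "v > 0" "N > 0"
proof -
  show 1: "a > 0" "b > 0" using k by (simp_all add: a_def b_def pochhammer_pos)
  show 2: "hA > 0" "hB > 0" using k by (simp_all add: hA_def hB_def gegenbauer_norm2_pos)
  show 3: "u > 0" "v > 0" using 1 by (simp_all add: u_def v_def)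
  show "N > 0" using 2 3 by (simp add: N_def add_pos_pos)
qed

lemma norms: "sin_integral k (\<lambda>x. (A x)\<^sup>2) = hA" "sin_integral k (\<lambda>x. (B x)\<^sup>2) = hB"
  using sin_integral_sin_square
  by (simp_all add: A_def B_def hA_def hB_def gegenbauer_norm2_def power_mult_distrib)

lemma orth:
  assumes "tri j (int (Suc n))"
  shows "sin_integral k (\<lambda>x. A x * cos (of_int j * x)) = 0" "sin_integral k (\<lambda>x. B x * sin (of_int j * x)) = 0"
proof -
  have j: "\<bar>j\<bar> < int (Suc n)" "\<bar>j\<bar> \<le> int n" using assms by (auto simp: tri_def)
  show "sin_integral k (\<lambda>x. A x * cos (of_int j * x)) = 0" "sin_integral k (\<lambda>x. B x * sin (of_int j * x)) = 0"
    unfolding A_def B_def using sin_integral_gegenbauer_cos[OF k j(1)] sin_integral_gegenbauer_sin[OF k j(2)] by auto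
qed

lemma ip_combination:
  "ip_k k (\<lambda>x. \<alpha> * of_real (A x) + \<beta> * of_real (B x)) (\<lambda>x. cis (of_int j * x)) =
    \<alpha> * of_real (sin_integral k (\<lambda>x. A x * cos (of_int j * x))) - \<i> * \<beta> * of_real (sin_integral k (\<lambda>x. B x * sin (of_int j * x)))"
  by (intro ip_k_combination k cont parity)

lemma ip_trig_below:
  assumes "trig_below (Suc n) f"
  shows "ip_k k (\<lambda>x. \<alpha> * of_real (A x) + \<beta> * of_real (B x)) f = 0"
proof -
  obtain c where c: "f = (\<lambda>x. \<Sum>j | tri j (int (Suc n)). c j * cis (of_int j * x))"
    using assms unfolding trig_below_def by blast
  have "ip_k k (\<lambda>x. \<alpha> * of_real (A x) + \<beta> * of_real (B x)) f =
     (\<Sum>j | tri j (int (Suc n)). cnj (c j) * ip_k k (\<lambda>x. \<alpha> * of_real (A x) + \<beta> * of_real (B x)) (\<lambda>x. cis (of_int j * x)))"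
    unfolding c by (intro ip_k_sum_right k continuous_intros cont finite_tri)
  also have "\<dots> = 0"
    by (intro sum.neutral ballI) (simp add: ip_combination orth)
  finally show ?thesis .
qed

lemma leading_A: "trig_below (Suc n) (\<lambda>x. of_real (A x) - of_real a * (cis (of_int (int (Suc n)) * x) + cis (of_int (- int (Suc n)) * x)))"
  unfolding A_def a_def by (rule even_part_leading)

lemma leading_B: "trig_below (Suc n) (\<lambda>x. 2 * \<i> * of_real (B x) - of_real b * (cis (of_int (int (Suc n)) * x) - cis (of_int (- int (Suc n)) * x)))"
  unfolding B_def b_def by (rule odd_part_leading)

text \<open>Modulo lower terms \<open>A\<close> is \<open>2 * a * cs\<close> and \<open>B\<close> is
  \<open>b * sn\<close>. Since \<open>A\<close> and \<open>B\<close> are orthogonal to lower terms,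
  their squared norms are these inner products times \<open>2 * a\<close> and
  \<open>b\<close>.\<close>

lemma ip_top:
  "sin_integral k (\<lambda>x. A x * cs x) = hA * u" "sin_integral k (\<lambda>x. B x * sn x) = hB * v"
proof -
  have R: "ip_k k (\<lambda>x. of_real (f x)) (\<lambda>x. of_real (g x)) = of_real (sin_integral k (\<lambda>x. f x * g x))"
    if "continuous_on UNIV f" "continuous_on UNIV g" for f g
  proof -
    have "((\<lambda>x. complex_of_real (\<bar>sin x\<bar> powr (2 * k) * (f x * g x))) has_integral of_real (sin_integral k (\<lambda>x. f x * g x))) {-pi..pi}"
      unfolding sin_integral_def
      by (intro has_integral_of_real integrable_integral sin_weight_integrable k continuous_intros
          continuous_on_subset[OF that(1)] continuous_on_subset[OF that(2)]) auto
    then show ?thesis unfolding ip_k_def by (subst (asm) mult.commute) (simp add: integral_unique)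
  qed
  have ccs: "continuous_on UNIV (\<lambda>x. 2 * a * cs x)" "continuous_on UNIV (\<lambda>x. b * sn x)"
    unfolding cs_def sn_def by (intro continuous_intros)+
  define fA where "fA x = of_real (A x) - of_real a * (cis (of_int (int (Suc n)) * x) + cis (of_int (- int (Suc n)) * x))" for x
  define fB where "fB x = 2 * \<i> * of_real (B x) - of_real b * (cis (of_int (int (Suc n)) * x) - cis (of_int (- int (Suc n)) * x))" for x
  have tA: "trig_below (Suc n) fA" unfolding fA_def by (rule leading_A)
  have tB: "trig_below (Suc n) (\<lambda>x. (1 / (2 * \<i>)) * fB x)" unfolding fB_def by (intro trig_below_cmult leading_B)
  have "ip_k k (\<lambda>x. of_real (A x)) (\<lambda>x. of_real (A x)) = ip_k k (\<lambda>x. of_real (A x)) (\<lambda>x. of_real (2 * a * cs x) + fA x)"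
  proof -
    have "complex_of_real (A x) = of_real (2 * a * cs x) + fA x" for x
      by (simp add: fA_def cs_def complex_eq_iff del: of_nat_Suc)
    then show ?thesis by simp
  qed
  also have "\<dots> = ip_k k (\<lambda>x. of_real (A x)) (\<lambda>x. of_real (2 * a * cs x)) + ip_k k (\<lambda>x. of_real (A x)) fA"
    by (intro ip_k_add_right k continuous_on_of_real cont ccs continuous_on_trig_below[OF tA])
  also have "ip_k k (\<lambda>x. of_real (A x)) fA = 0"
    using ip_trig_below[OF tA, of 1 0] by simp
  finally have "sin_integral k (\<lambda>x. A x * A x) = sin_integral k (\<lambda>x. A x * (2 * a * cs x))"
    unfolding R[OF cont(1) cont(1)] R[OF cont(1) ccs(1)] by (simp del: of_real_mult)
  also have "\<dots> = 2 * a * sin_integral k (\<lambda>x. A x * cs x)"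
    unfolding sin_integral_cmult[symmetric] by (simp add: mult_ac)
  finally show "sin_integral k (\<lambda>x. A x * cs x) = hA * u"
    using norms(1) pos by (simp add: power2_eq_square u_def field_simps)
  have "ip_k k (\<lambda>x. of_real (B x)) (\<lambda>x. of_real (B x)) = ip_k k (\<lambda>x. of_real (B x)) (\<lambda>x. of_real (b * sn x) + (1 / (2 * \<i>)) * fB x)"
  proof -
    have "complex_of_real (B x) = of_real (b * sn x) + (1 / (2 * \<i>)) * fB x" for x
      by (simp add: fB_def sn_def complex_eq_iff diff_divide_distrib del: of_nat_Suc)
    then show ?thesis by simp
  qed
  also have "\<dots> = ip_k k (\<lambda>x. of_real (B x)) (\<lambda>x. of_real (b * sn x)) + ip_k k (\<lambda>x. of_real (B x)) (\<lambda>x. (1 / (2 * \<i>)) * fB x)"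
    by (intro ip_k_add_right k continuous_on_of_real cont ccs continuous_on_trig_below[OF tB])
  also have "ip_k k (\<lambda>x. of_real (B x)) (\<lambda>x. (1 / (2 * \<i>)) * fB x) = 0"
    using ip_trig_below[OF tB, of 0 1] by simp
  finally have "sin_integral k (\<lambda>x. B x * B x) = sin_integral k (\<lambda>x. B x * (b * sn x))"
    unfolding R[OF cont(2) cont(2)] R[OF cont(2) ccs(2)] by (simp del: of_real_mult)
  also have "\<dots> = b * sin_integral k (\<lambda>x. B x * sn x)"
    unfolding sin_integral_cmult[symmetric] by (simp add: mult_ac)
  finally show "sin_integral k (\<lambda>x. B x * sn x) = hB * v"
    using norms(2) pos by (simp add: power2_eq_square v_def field_simps)
qed

lemma combination_leading:
  "\<exists>c. \<forall>x. \<alpha> * of_real (A x) + \<beta> * of_real (B x) =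
     (\<alpha> * of_real a + \<beta> * of_real b / (2 * \<i>)) * cis (of_int (int (Suc n)) * x)
     + (\<alpha> * of_real a - \<beta> * of_real b / (2 * \<i>)) * cis (of_int (- int (Suc n)) * x)
     + (\<Sum>j | tri j (int (Suc n)). c j * cis (of_int j * x))"
proof -
  have "trig_below (Suc n) (\<lambda>x. \<alpha> * (of_real (A x) - of_real a * (cis (of_int (int (Suc n)) * x) + cis (of_int (- int (Suc n)) * x)))
     + (\<beta> / (2 * \<i>)) * (2 * \<i> * of_real (B x) - of_real b * (cis (of_int (int (Suc n)) * x) - cis (of_int (- int (Suc n)) * x))))"
    by (intro trig_below_add trig_below_cmult leading_A leading_B)
  then obtain c where c: "\<And>x. \<alpha> * (of_real (A x) - of_real a * (cis (of_int (int (Suc n)) * x) + cis (of_int (- int (Suc n)) * x)))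
     + (\<beta> / (2 * \<i>)) * (2 * \<i> * of_real (B x) - of_real b * (cis (of_int (int (Suc n)) * x) - cis (of_int (- int (Suc n)) * x)))
     = (\<Sum>j | tri j (int (Suc n)). c j * cis (of_int j * x))"
    unfolding trig_below_def by blast
  show ?thesis
    by (rule exI[of _ c]) (unfold c[symmetric], simp add: field_simps)
qed

lemma HO_E_pos:
  "HO_E k (int (Suc n)) (\<i> * of_real x) = of_real (u * A x) + \<i> * of_real (v * B x)"
proof -
  define \<alpha> where "\<alpha> = complex_of_real u"
  define \<beta> where "\<beta> = \<i> * complex_of_real v"
  have 1: "\<alpha> * of_real a = 1/2" "\<beta> * of_real b / (2 * \<i>) = 1/2"
    using pos by (simp_all add: \<alpha>_def \<beta>_def u_def v_def)
  obtain c where c: "\<And>x. \<alpha> * of_real (A x) + \<beta> * of_real (B x) =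
     (\<alpha> * of_real a + \<beta> * of_real b / (2 * \<i>)) * cis (of_int (int (Suc n)) * x)
     + (\<alpha> * of_real a - \<beta> * of_real b / (2 * \<i>)) * cis (of_int (- int (Suc n)) * x)
     + (\<Sum>j | tri j (int (Suc n)). c j * cis (of_int j * x))"
    using combination_leading by blast
  have "HO_E k (int (Suc n)) (\<i> * of_real x) = \<alpha> * of_real (A x) + \<beta> * of_real (B x)"
  proof (rule HO_E_eqI[OF k])
    show "\<alpha> * of_real (A x) + \<beta> * of_real (B x) = cis (of_int (int (Suc n)) * x) + (\<Sum>j | tri j (int (Suc n)). c j * cis (of_int j * x))" for x
      unfolding c 1 by simp
    show "ip_k k (\<lambda>x. \<alpha> * of_real (A x) + \<beta> * of_real (B x)) (\<lambda>x. cis (of_int j * x)) = 0" if "tri j (int (Suc n))" for j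
      using orth[OF that] by (simp add: ip_combination)
  qed
  then show ?thesis by (simp add: \<alpha>_def \<beta>_def)
qed

lemma HO_E_neg:
  "HO_E k (- int (Suc n)) (\<i> * of_real x) =
     of_real (2 * u * v / N) * (of_real (hB * v * A x) - \<i> * of_real (hA * u * B x))"
proof -
  \<comment> \<open>In \<open>hB v A - \<i> hA u B\<close> the coefficient at the frequency
    \<open>-m\<close> is \<open>N / (2 * u * v)\<close>; \<open>l\<close> scales it to 1.\<close>
  define l where "l = 2 * u * v / N"
  define \<alpha> where "\<alpha> = complex_of_real (l * hB * v)"
  define \<beta> where "\<beta> = - \<i> * complex_of_real (l * hA * u)"
  have ab: "a = 1 / (2 * u)" "b = 1 / v" using pos by (simp_all add: u_def v_def)
  have "l * hB * v * a + l * hA * u * b / 2 = l * (u\<^sup>2 * hA + v\<^sup>2 * hB) / (2 * u * v)"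
    using pos(5,6) unfolding ab by (simp add: field_simps power2_eq_square)
  then have "l * hB * v * a + l * hA * u * b / 2 = 1"
    using pos(5,6,7) by (simp add: N_def[symmetric] l_def)
  then have "complex_of_real (l * hB * v * a + l * hA * u * b / 2) = 1" by simp
  then have 1: "\<alpha> * of_real a - \<beta> * of_real b / (2 * \<i>) = 1"
    by (simp add: \<alpha>_def \<beta>_def complex_eq_iff)
  obtain c where c: "\<And>x. \<alpha> * of_real (A x) + \<beta> * of_real (B x) =
     (\<alpha> * of_real a + \<beta> * of_real b / (2 * \<i>)) * cis (of_int (int (Suc n)) * x)
     + (\<alpha> * of_real a - \<beta> * of_real b / (2 * \<i>)) * cis (of_int (- int (Suc n)) * x)
     + (\<Sum>j | tri j (int (Suc n)). c j * cis (of_int j * x))"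
    using combination_leading by blast
  \<comment> \<open>For index \<open>-m\<close> the frequency \<open>m\<close> counts as lower
    order, so its coefficient joins the sum.\<close>
  define d where "d = c(int (Suc n) := \<alpha> * of_real a + \<beta> * of_real b / (2 * \<i>))"
  have S: "{j. tri j (- int (Suc n))} = insert (int (Suc n)) {j. tri j (int (Suc n))}"
    by (auto simp: tri_uminus_of_nat simp del: of_nat_Suc)
  have nt: "\<not> tri (int (Suc n)) (int (Suc n))" by (simp add: tri_def)
  have "HO_E k (- int (Suc n)) (\<i> * of_real x) = \<alpha> * of_real (A x) + \<beta> * of_real (B x)"
  proof (rule HO_E_eqI[OF k])
    show "\<alpha> * of_real (A x) + \<beta> * of_real (B x) = cis (of_int (- int (Suc n)) * x) + (\<Sum>j | tri j (- int (Suc n)). d j * cis (of_int j * x))" for x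
    proof -
      have "(\<Sum>j | tri j (int (Suc n)). d j * cis (of_int j * x)) = (\<Sum>j | tri j (int (Suc n)). c j * cis (of_int j * x))"
        using nt by (intro sum.cong) (auto simp: d_def)
      then show ?thesis
        unfolding c 1 S using nt by (simp add: d_def del: of_nat_Suc)
    qed
    show "ip_k k (\<lambda>x. \<alpha> * of_real (A x) + \<beta> * of_real (B x)) (\<lambda>x. cis (of_int j * x)) = 0" if "tri j (- int (Suc n))" for j
    proof (cases "j = int (Suc n)")
      case True
      show ?thesis
        unfolding True ip_combination ip_top[unfolded cs_def sn_def] by (simp add: \<alpha>_def \<beta>_def)
    next
      case False
      then show ?thesis using that orth[of j] by (simp add: tri_uminus_of_nat ip_combination del: of_nat_Suc)
    qed
  qed
  then show ?thesis by (simp add: \<alpha>_def \<beta>_def l_def algebra_simps)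
qed

lemma norm2_combination:
  assumes "\<And>x. cmod (HO_E k m (\<i> * of_real x)) ^ 2 = p * (A x)\<^sup>2 + q * (B x)\<^sup>2"
  shows "norm2_k k m = p * hA + q * hB"
proof -
  have "norm2_k k m = sin_integral k (\<lambda>x. p * (A x)\<^sup>2 + q * (B x)\<^sup>2)"
    unfolding norm2_k_def sin_integral_def assms by (simp add: mult.commute)
  also have "\<dots> = p * hA + q * hB"
    unfolding norms[symmetric] by (intro sin_integral_linear k continuous_intros cont)
  finally show ?thesis .
qed

text \<open>There is no mixed term: \<open>A\<close> has a real and \<open>B\<close> a purely
  imaginary coefficient.\<close>

lemma cmod_HO_E:
  "(cmod (HO_E k (int (Suc n)) (\<i> * of_real x)))\<^sup>2 = u\<^sup>2 * (A x)\<^sup>2 + v\<^sup>2 * (B x)\<^sup>2"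
  "(cmod (HO_E k (- int (Suc n)) (\<i> * of_real x)))\<^sup>2 = (2 * u * v / N)\<^sup>2 * ((hB * v)\<^sup>2 * (A x)\<^sup>2 + (hA * u)\<^sup>2 * (B x)\<^sup>2)"
proof -
  show "(cmod (HO_E k (int (Suc n)) (\<i> * of_real x)))\<^sup>2 = u\<^sup>2 * (A x)\<^sup>2 + v\<^sup>2 * (B x)\<^sup>2"
    unfolding HO_E_pos cmod_power2 by (simp add: power_mult_distrib)
  have "(cmod (HO_E k (- int (Suc n)) (\<i> * of_real x)))\<^sup>2 =
      (2 * u * v / N)\<^sup>2 * (cmod (of_real (hB * v * A x) - \<i> * of_real (hA * u * B x)))\<^sup>2"
    unfolding HO_E_neg norm_mult power_mult_distrib norm_of_real power2_abs ..
  also have "(cmod (of_real (hB * v * A x) - \<i> * of_real (hA * u * B x)))\<^sup>2 = (hB * v)\<^sup>2 * (A x)\<^sup>2 + (hA * u)\<^sup>2 * (B x)\<^sup>2"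
    unfolding cmod_power2 by (simp add: power_mult_distrib)
  finally show "(cmod (HO_E k (- int (Suc n)) (\<i> * of_real x)))\<^sup>2 = (2 * u * v / N)\<^sup>2 * ((hB * v)\<^sup>2 * (A x)\<^sup>2 + (hA * u)\<^sup>2 * (B x)\<^sup>2)" .
qed

lemma norm2_HO_E:
  "norm2_k k (int (Suc n)) = N" "norm2_k k (- int (Suc n)) = (2 * u * v / N)\<^sup>2 * (hA * hB * N)"
proof -
  show "norm2_k k (int (Suc n)) = N"
    unfolding N_def by (rule norm2_combination) (rule cmod_HO_E)
  have "norm2_k k (- int (Suc n)) = (2 * u * v / N)\<^sup>2 * (hB * v)\<^sup>2 * hA + (2 * u * v / N)\<^sup>2 * (hA * u)\<^sup>2 * hB"
    by (rule norm2_combination) (unfold cmod_HO_E, simp add: algebra_simps)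
  also have "\<dots> = (2 * u * v / N)\<^sup>2 * (hA * hB * N)"
  proof -
    have "L * (hB * v)\<^sup>2 * hA + L * (hA * u)\<^sup>2 * hB = L * (hA * hB * N)" for L
      unfolding N_def by (simp add: algebra_simps power2_eq_square)
    then show ?thesis .
  qed
  finally show "norm2_k k (- int (Suc n)) = (2 * u * v / N)\<^sup>2 * (hA * hB * N)" .
qed

text \<open>The reproducing kernel of a plane does not depend on the orthogonal basis. This is
  checked by expansion: in the real part the definition of \<open>N\<close> cancels the denominator
  \<open>N\<close>.\<close>

lemma kernel:
  "of_real (gamma_k k (int (Suc n))) * HO_E k (int (Suc n)) (\<i> * of_real x) * HO_E k (int (Suc n)) (- (\<i> * of_real y)) +
   of_real (gamma_k k (- int (Suc n))) * HO_E k (- int (Suc n)) (\<i> * of_real x) * HO_E k (- int (Suc n)) (- (\<i> * of_real y))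
   = of_real (A x * A y / hA + B x * B y / hB)"
proof -
  define l where "l = 2 * u * v / N"
  have l: "l > 0" using pos by (simp add: l_def)
  define X where "X = of_real (hB * v * A x) - \<i> * of_real (hA * u * B x)"
  define Y where "Y = of_real (hB * v * A y) + \<i> * of_real (hA * u * B y)"
  have "of_real (gamma_k k (- int (Suc n))) * HO_E k (- int (Suc n)) (\<i> * of_real x) * HO_E k (- int (Suc n)) (- (\<i> * of_real y))
     = of_real (1 / (l\<^sup>2 * (hA * hB * N))) * (of_real l * X) * (of_real l * Y)"
    unfolding HO_E_minus_arg gamma_k_def norm2_HO_E HO_E_neg parity l_def[symmetric] X_def Y_def by simp
  also have "\<dots> = of_real (l\<^sup>2 * (1 / (l\<^sup>2 * (hA * hB * N)))) * (X * Y)"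
    by (simp add: power2_eq_square)
  also have "l\<^sup>2 * (1 / (l\<^sup>2 * (hA * hB * N))) = 1 / (hA * hB * N)" using l by simp
  finally have neg: "of_real (gamma_k k (- int (Suc n))) * HO_E k (- int (Suc n)) (\<i> * of_real x) * HO_E k (- int (Suc n)) (- (\<i> * of_real y))
     = of_real (1 / (hA * hB * N)) * (X * Y)" .
  have ps: "of_real (gamma_k k (int (Suc n))) * HO_E k (int (Suc n)) (\<i> * of_real x) * HO_E k (int (Suc n)) (- (\<i> * of_real y))
     = of_real (1 / N) * ((of_real (u * A x) + \<i> * of_real (v * B x)) * (of_real (u * A y) - \<i> * of_real (v * B y)))"
    unfolding HO_E_minus_arg gamma_k_def norm2_HO_E HO_E_pos parity by simp
  show ?thesis
  proof (rule complex_eqI)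
    show "Re (of_real (gamma_k k (int (Suc n))) * HO_E k (int (Suc n)) (\<i> * of_real x) * HO_E k (int (Suc n)) (- (\<i> * of_real y)) +
       of_real (gamma_k k (- int (Suc n))) * HO_E k (- int (Suc n)) (\<i> * of_real x) * HO_E k (- int (Suc n)) (- (\<i> * of_real y)))
      = Re (of_real (A x * A y / hA + B x * B y / hB))"
    proof -
      have "(u * A x) * (u * A y) + (v * B x) * (v * B y) + ((hB * v * A x) * (hB * v * A y) + (hA * u * B x) * (hA * u * B y)) / (hA * hB)
        = N * (A x * A y / hA + B x * B y / hB)"
        using pos(3,4) by (simp add: N_def field_simps power2_eq_square)
      moreover have "P / N + Q / (hA * hB * N) = (P + Q / (hA * hB)) / N" for P Q
        by (simp add: add_divide_distrib)
      ultimately have "((u * A x) * (u * A y) + (v * B x) * (v * B y)) / N + ((hB * v * A x) * (hB * v * A y) + (hA * u * B x) * (hA * u * B y)) / (hA * hB * N)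
        = A x * A y / hA + B x * B y / hB"
        using pos(7) by simp
      then show ?thesis unfolding ps neg X_def Y_def by simp
    qed
    \<comment> \<open>The imaginary parts are opposite multiples, by \<open>u * v / N\<close>, of
      \<open>B x * A y - A x * B y\<close>.\<close>
    have "hA * u * (hB * v) / (hA * hB * N) = u * v / N" using pos by simp
    then show "Im (of_real (gamma_k k (int (Suc n))) * HO_E k (int (Suc n)) (\<i> * of_real x) * HO_E k (int (Suc n)) (- (\<i> * of_real y)) +
       of_real (gamma_k k (- int (Suc n))) * HO_E k (- int (Suc n)) (\<i> * of_real x) * HO_E k (- int (Suc n)) (- (\<i> * of_real y)))
      = Im (of_real (A x * A y / hA + B x * B y / hB))"
      unfolding ps neg X_def Y_def using pos(3,4,7) by (simp add: field_simps)
  qed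
qed

end

section \<open>The Poisson kernel\<close>

text \<open>The coefficient of \<open>r ^ m\<close> in the claimed integral without
  \<open>r powr k\<close>, found by expanding its integrand with
  \<open>sums_gegenbauer_poisson\<close>.\<close>

definition poisson_coeff :: "real \<Rightarrow> nat \<Rightarrow> real \<Rightarrow> real \<Rightarrow> real" where
  "poisson_coeff k m x y = (real m + k) / (2 * pi) *
     integral {-1..1} (\<lambda>u. (1 - u\<^sup>2) powr (k - 1) * ((1 + u) * gegenbauer k m (cos x * cos y + u * (sin x * sin y))))"

lemma poisson_coeff_split:
  assumes "k > 0"
  shows "poisson_coeff k m x y = (real m + k) / (2 * pi) * (gegenbauer_mean k m (cos x * cos y) (sin x * sin y) +
    integral {-1..1} (\<lambda>u. (1 - u\<^sup>2) powr (k - 1) * (u * gegenbauer k m (cos x * cos y + u * (sin x * sin y)))))"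
proof -
  let ?g = "\<lambda>u. gegenbauer k m (cos x * cos y + u * (sin x * sin y))"
  have "integral {-1..1} (\<lambda>u. (1 - u\<^sup>2) powr (k - 1) * ((1 + u) * ?g u)) =
     integral {-1..1} (\<lambda>u. (1 - u\<^sup>2) powr (k - 1) * ?g u + (1 - u\<^sup>2) powr (k - 1) * (u * ?g u))"
    by (simp add: algebra_simps)
  also have "\<dots> = gegenbauer_mean k m (cos x * cos y) (sin x * sin y) + integral {-1..1} (\<lambda>u. (1 - u\<^sup>2) powr (k - 1) * (u * ?g u))"
    unfolding gegenbauer_mean_def by (intro integral_add jacobi_weight_integrable assms continuous_intros)
  finally show ?thesis by (simp add: poisson_coeff_def)
qed

text \<open>The factor \<open>jacobi_mass k / gegenbauer k m 1\<close> occurs in the product formula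
  and, inverted, in the norm, so only \<open>(m + k) / (2 * pi)\<close> is left.\<close>

lemma gegenbauer_mean_eq_norm2:
  assumes "k > 0"
  shows "(real m + k) / (2 * pi) * gegenbauer_mean k m (cos x * cos y) (sin x * sin y) =
    gegenbauer k m (cos x) * gegenbauer k m (cos y) / gegenbauer_norm2 k m"
proof -
  have p: "gegenbauer k m 1 > 0" "jacobi_mass k > 0" "real m + k > 0"
    using assms gegenbauer_one_pos jacobi_mass_pos by auto
  have "gegenbauer_mean k m (cos x * cos y) (sin x * sin y) = jacobi_mass k * gegenbauer k m (cos x) * gegenbauer k m (cos y) / gegenbauer k m 1"
    using gegenbauer_product_formula[OF assms, of "sin x" "cos x" "sin y" "cos y" m] p
    by (simp add: sin_squared_eq nonzero_eq_divide_eq)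
  then show ?thesis unfolding gegenbauer_norm2_eq[OF assms] using p by simp
qed

lemma poisson_coeff_0:
  assumes "k > 0"
  shows "poisson_coeff k 0 x y = 1 / gegenbauer_norm2 k 0"
  unfolding poisson_coeff_split[OF assms] gegenbauer_mean_odd(2)[OF assms]
  using gegenbauer_mean_eq_norm2[OF assms, of 0] by simp

text \<open>The expression is a convex combination of \<open>cos (x - y)\<close> and
  \<open>cos (x + y)\<close>.\<close>

lemma abs_convex_cos_le_1:
  assumes "u \<in> {-1..1}"
  shows "\<bar>cos x * cos y + u * (sin x * sin y)\<bar> \<le> (1::real)"
proof -
  have "cos x * cos y + u * (sin x * sin y) = (1 + u) / 2 * cos (x - y) + (1 - u) / 2 * cos (x + y)"
    by (simp add: cos_add cos_diff field_simps)
  moreover have "\<bar>(1 + u) / 2 * cos (x - y)\<bar> \<le> (1 + u) / 2 * 1" "\<bar>(1 - u) / 2 * cos (x + y)\<bar> \<le> (1 - u) / 2 * 1"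
    unfolding abs_mult using assms by (intro mult_mono; simp)+
  ultimately show ?thesis by (simp add: field_simps)
qed

lemma sums_poisson_coeff:
  assumes "k > 0" "0 \<le> r" "r < 1"
  shows "(\<lambda>m. poisson_coeff k m x y * r ^ m) sums (k / (2 * pi) * (1 - r\<^sup>2) *
     integral {-1..1} (\<lambda>u. (1 + u) * (1 - u\<^sup>2) powr (k - 1) /
              (1 - 2 * r * (cos x * cos y + u * sin x * sin y) + r\<^sup>2) powr (k + 1)))"
proof -
  define t where "t u = cos x * cos y + u * (sin x * sin y)" for u
  define w where "w u = (1 - u\<^sup>2) powr (k - 1)" for u :: real
  define s where "s m u = (real m + k) * gegenbauer k m (t u) * r ^ m" for m u
  \<comment> \<open>\<open>M\<close> is the series at \<open>t = 1\<close>; by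
    \<open>gegenbauer_abs_le\<close> it bounds all partial sums, and with
    \<open>1 + u \<le> 2\<close> it gives an integrable majorant.\<close>
  define M where "M = (\<Sum>m. (real m + k) * gegenbauer k m 1 * r ^ m)"
  have sM: "summable (\<lambda>m. (real m + k) * gegenbauer k m 1 * r ^ m)"
    using sums_gegenbauer_poisson[of k 1 r] assms by (auto simp: sums_iff)
  have t: "\<bar>t u\<bar> \<le> 1" if "u \<in> {-1..1}" for u
    unfolding t_def by (rule abs_convex_cos_le_1[OF that])
  have ct: "continuous_on S t" for S unfolding t_def by (intro continuous_intros)
  have int: "(\<lambda>u. w u * ((1 + u) * s m u)) integrable_on {-1..1}" for m
    unfolding w_def s_def by (intro jacobi_weight_integrable assms continuous_intros ct)
  have bound: "norm (\<Sum>m<N. w u * ((1 + u) * s m u)) \<le> w u * (2 * M)" if u: "u \<in> {-1..1}" for N u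
  proof -
    have "\<bar>\<Sum>m<N. s m u\<bar> \<le> (\<Sum>m<N. (real m + k) * gegenbauer k m 1 * r ^ m)"
    proof (rule order_trans[OF sum_abs sum_mono])
      fix m
      have "\<bar>s m u\<bar> = (real m + k) * \<bar>gegenbauer k m (t u)\<bar> * r ^ m"
        using assms by (simp add: s_def abs_mult)
      also have "\<dots> \<le> (real m + k) * gegenbauer k m 1 * r ^ m"
        using assms gegenbauer_abs_le[OF assms(1) t[OF u]] by (intro mult_right_mono mult_left_mono) auto
      finally show "\<bar>s m u\<bar> \<le> (real m + k) * gegenbauer k m 1 * r ^ m" .
    qed
    also have "\<dots> \<le> M"
      unfolding M_def using assms less_imp_le[OF gegenbauer_one_pos[OF assms(1)]]
      by (intro sum_le_suminf sM) auto
    finally have 1: "\<bar>\<Sum>m<N. s m u\<bar> \<le> M" .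
    have "norm (\<Sum>m<N. w u * ((1 + u) * s m u)) = w u * ((1 + u) * \<bar>\<Sum>m<N. s m u\<bar>)"
      using u by (simp add: sum_distrib_left[symmetric] abs_mult w_def)
    also have "\<dots> \<le> w u * (2 * M)"
      using u 1 by (intro mult_left_mono mult_mono) (auto simp: w_def)
    finally show ?thesis .
  qed
  define G where "G u = w u * ((1 + u) * (k * (1 - r\<^sup>2) / (1 - 2 * r * t u + r\<^sup>2) powr (k + 1)))" for u
  have lim: "(\<lambda>N. \<Sum>m<N. w u * ((1 + u) * s m u)) \<longlonglongrightarrow> G u" if u: "u \<in> {-1..1}" for u
  proof -
    have "(\<lambda>m. w u * ((1 + u) * s m u)) sums G u"
      unfolding G_def s_def by (intro sums_mult sums_gegenbauer_poisson assms t u)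
    then show ?thesis by (simp add: sums_def)
  qed
  have wM: "(\<lambda>u. w u * (2 * M)) integrable_on {-1..1}"
    unfolding w_def by (intro jacobi_weight_integrable assms continuous_intros)
  have "(\<lambda>N. integral {-1..1} (\<lambda>u. \<Sum>m<N. w u * ((1 + u) * s m u))) \<longlonglongrightarrow> integral {-1..1} G"
    by (rule dominated_convergence(2)[OF _ wM bound lim]) (auto intro!: integrable_sum int)
  moreover have "integral {-1..1} (\<lambda>u. \<Sum>m<N. w u * ((1 + u) * s m u)) = (\<Sum>m<N. 2 * pi * (poisson_coeff k m x y * r ^ m))" for N
  proof -
    have "integral {-1..1} (\<lambda>u. w u * ((1 + u) * s m u)) = 2 * pi * (poisson_coeff k m x y * r ^ m)" for m
    proof -
      have "integral {-1..1} (\<lambda>u. w u * ((1 + u) * s m u)) =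
         integral {-1..1} (\<lambda>u. ((real m + k) * r ^ m) * (w u * ((1 + u) * gegenbauer k m (t u))))"
        by (simp add: s_def mult_ac)
      also have "\<dots> = 2 * pi * (poisson_coeff k m x y * r ^ m)"
        by (simp add: poisson_coeff_def w_def t_def)
      finally show ?thesis .
    qed
    then show ?thesis by (subst integral_sum) (auto intro!: int)
  qed
  ultimately have "(\<lambda>m. 2 * pi * (poisson_coeff k m x y * r ^ m)) sums integral {-1..1} G"
    by (simp add: sums_def)
  then have "(\<lambda>m. (1 / (2 * pi)) * (2 * pi * (poisson_coeff k m x y * r ^ m))) sums ((1 / (2 * pi)) * integral {-1..1} G)"
    by (rule sums_mult)
  moreover have "integral {-1..1} G = k * (1 - r\<^sup>2) * integral {-1..1} (\<lambda>u. (1 + u) * (1 - u\<^sup>2) powr (k - 1) /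
              (1 - 2 * r * (cos x * cos y + u * sin x * sin y) + r\<^sup>2) powr (k + 1))"
    unfolding integral_mult_right[symmetric] G_def w_def t_def by (simp add: mult_ac)
  ultimately show ?thesis by simp
qed

lemma HO_E_0: "HO_E k 0 z = 1"
proof -
  have "{j. tri j 0} = {}" by (auto simp: tri_def)
  then show ?thesis by (simp add: HO_E_def Eform_def)
qed

lemma gamma_k_0:
  assumes "k > 0"
  shows "gamma_k k 0 = poisson_coeff k 0 x y"
  unfolding poisson_coeff_0[OF assms]
  by (simp add: gamma_k_def norm2_k_def HO_E_0 gegenbauer_norm2_def sin_integral_def)

context ho_level
begin

lemma kernel_poisson_coeff: "A x * A y / hA + B x * B y / hB = poisson_coeff k (Suc n) x y"
proof -
  \<comment> \<open>Since \<open>Suc n + k = n + (k + 1)\<close>, the even part at \<open>k\<close>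
    and the odd part at \<open>k + 1\<close> have the prefactor required by
    \<open>gegenbauer_mean_eq_norm2\<close>.\<close>
  have "poisson_coeff k (Suc n) x y = (real (Suc n) + k) / (2 * pi) * gegenbauer_mean k (Suc n) (cos x * cos y) (sin x * sin y)
     + sin x * sin y * ((real n + (k + 1)) / (2 * pi) * gegenbauer_mean (k + 1) n (cos x * cos y) (sin x * sin y))"
    unfolding poisson_coeff_split[OF k] gegenbauer_mean_odd(1)[OF k] by (simp add: algebra_simps)
  also have "\<dots> = A x * A y / hA + B x * B y / hB"
    using gegenbauer_mean_eq_norm2[OF k, of "Suc n" x y] gegenbauer_mean_eq_norm2[of "k + 1" n x y] k
    by (simp add: A_def B_def hA_def hB_def del: of_nat_Suc)
  finally show ?thesis by simp
qed

lemma HO_E_cnj: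
  assumes "m = int (Suc n) \<or> m = - int (Suc n)"
  shows "HO_E k m (- (\<i> * of_real y)) = cnj (HO_E k m (\<i> * of_real y))"
  using assms unfolding HO_E_minus_arg by (elim disjE) (simp_all only: HO_E_pos HO_E_neg parity, simp_all)

lemma gamma_nonneg:
  assumes "m = int (Suc n) \<or> m = - int (Suc n)"
  shows "gamma_k k m \<ge> 0"
  using assms pos by (elim disjE) (simp_all only: gamma_k_def norm2_HO_E, simp_all)

lemma kernel_diagonal:
  "gamma_k k (int (Suc n)) * (cmod (HO_E k (int (Suc n)) (\<i> * of_real x)))\<^sup>2 +
   gamma_k k (- int (Suc n)) * (cmod (HO_E k (- int (Suc n)) (\<i> * of_real x)))\<^sup>2 = poisson_coeff k (Suc n) x x"
proof -
  have "complex_of_real (gamma_k k (int (Suc n)) * (cmod (HO_E k (int (Suc n)) (\<i> * of_real x)))\<^sup>2 +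
      gamma_k k (- int (Suc n)) * (cmod (HO_E k (- int (Suc n)) (\<i> * of_real x)))\<^sup>2) = of_real (poisson_coeff k (Suc n) x x)"
    using kernel[of x x] unfolding kernel_poisson_coeff of_real_add of_real_mult complex_norm_square
    by (simp only: HO_E_cnj[OF disjI1[OF refl]] HO_E_cnj[OF disjI2[OF refl]] mult.assoc)
  then show ?thesis by (simp only: of_real_eq_iff)
qed

text \<open>On the diagonal both terms of \<open>kernel_diagonal\<close> are nonnegative, so each is
  bounded by the pair; \<open>2 p q \<le> p^2 + q^2\<close> extends the bound to two points.\<close>

lemma norm_kernel_term_le:
  assumes "m = int (Suc n) \<or> m = - int (Suc n)"
  shows "gamma_k k m * cmod (HO_E k m (\<i> * of_real x)) * cmod (HO_E k m (- (\<i> * of_real y)))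
     \<le> (poisson_coeff k (Suc n) x x + poisson_coeff k (Suc n) y y) / 2"
proof -
  have d: "gamma_k k m * (cmod (HO_E k m (\<i> * of_real z)))\<^sup>2 \<le> poisson_coeff k (Suc n) z z" for z
    using assms kernel_diagonal[of z] gamma_nonneg[of "int (Suc n)"] gamma_nonneg[of "- int (Suc n)"]
    by (smt (verit) mult_nonneg_nonneg zero_le_power2)
  define p q where "p = cmod (HO_E k m (\<i> * of_real x))" and "q = cmod (HO_E k m (\<i> * of_real y))"
  have "gamma_k k m * cmod (HO_E k m (\<i> * of_real x)) * cmod (HO_E k m (- (\<i> * of_real y))) = gamma_k k m * (p * q)"
    unfolding HO_E_cnj[OF assms] p_def q_def by simp
  also have "p * q \<le> (p\<^sup>2 + q\<^sup>2) / 2" using sum_squares_bound[of p q] by simp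
  then have "gamma_k k m * (p * q) \<le> gamma_k k m * ((p\<^sup>2 + q\<^sup>2) / 2)"
    by (rule mult_left_mono) (rule gamma_nonneg[OF assms])
  also have "\<dots> \<le> (poisson_coeff k (Suc n) x x + poisson_coeff k (Suc n) y y) / 2"
    using d[of x] d[of y] by (simp add: p_def q_def algebra_simps)
  finally show ?thesis .
qed

end

text \<open>Convergence of the paired series does not yield unconditional summability, hence the
  separate absolute summability of the positive and the negative half.\<close>

lemma has_sum_int_pairing:
  fixes f :: "int \<Rightarrow> 'a :: banach"
  assumes "summable (\<lambda>n. norm (f (int (Suc n))))" "summable (\<lambda>n. norm (f (- int (Suc n))))"
    and "(\<lambda>n. f (int (Suc n)) + f (- int (Suc n))) sums S"
  shows "(f has_sum (f 0 + S)) UNIV"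
proof -
  have half: "(f has_sum (\<Sum>n. f (g n))) (range g)" if "inj g" "summable (\<lambda>n. norm (f (g n)))" for g :: "nat \<Rightarrow> int"
  proof -
    have "((\<lambda>n. f (g n)) has_sum (\<Sum>n. f (g n))) UNIV"
      by (rule norm_summable_imp_has_sum[OF that(2)]) (rule summable_sums[OF summable_norm_cancel[OF that(2)]])
    then show ?thesis using has_sum_reindex[OF that(1), of f] by (simp add: o_def)
  qed
  have 1: "(f has_sum (\<Sum>n. f (int (Suc n)))) (range (\<lambda>n. int (Suc n)))"
    by (rule half) (auto simp: inj_on_def assms simp del: of_nat_Suc)
  have 2: "(f has_sum (\<Sum>n. f (- int (Suc n)))) (range (\<lambda>n. - int (Suc n)))"
    by (rule half) (auto simp: inj_on_def assms simp del: of_nat_Suc)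
  have 0: "(f has_sum f 0) {0}" using has_sum_finite[of "{0}" f] by simp
  have "(f has_sum (f 0 + (\<Sum>n. f (int (Suc n))))) ({0} \<union> range (\<lambda>n. int (Suc n)))"
    by (rule has_sum_Un_disjoint[OF 0 1]) auto
  then have "(f has_sum (f 0 + (\<Sum>n. f (int (Suc n))) + (\<Sum>n. f (- int (Suc n))))) ({0} \<union> range (\<lambda>n. int (Suc n)) \<union> range (\<lambda>n. - int (Suc n)))"
    by (rule has_sum_Un_disjoint[OF _ 2]) auto
  moreover have "{0} \<union> range (\<lambda>n. int (Suc n)) \<union> range (\<lambda>n. - int (Suc n)) = UNIV"
  proof -
    have "i \<in> {0} \<union> range (\<lambda>n. int (Suc n)) \<union> range (\<lambda>n. - int (Suc n))" for i
    proof (cases i rule: int_cases3)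
      case (pos n)
      then have "i = int (Suc (n - 1))" by simp
      then show ?thesis by blast
    next
      case (neg n)
      then have "i = - int (Suc (n - 1))" by simp
      then show ?thesis by blast
    qed simp
    then show ?thesis by blast
  qed
  moreover have "(\<Sum>n. f (int (Suc n))) + (\<Sum>n. f (- int (Suc n))) = S"
    using assms by (subst suminf_add) (auto intro: summable_norm_cancel simp: sums_iff simp del: of_nat_Suc)
  ultimately show ?thesis by (simp add: add.assoc del: of_nat_Suc)
qed

theorem mainTheorem4:
  fixes k r x y :: real
  assumes "k > 0" and "0 \<le> r" and "r < 1"
    and "x \<in> {-pi..pi}" and "y \<in> {-pi..pi}"
  shows "((\<lambda>n::int. complex_of_real (gamma_k k n * r powr (real_of_int \<bar>n\<bar> + k))
              * HO_E k n (\<i> * of_real x) * HO_E k n (- (\<i> * of_real y)))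
          has_sum
          complex_of_real (k / (2 * pi) * (1 - r\<^sup>2) * r powr k *
            integral {-1..1} (\<lambda>u. (1 + u) * (1 - u\<^sup>2) powr (k - 1) /
              (1 - 2 * r * (cos x * cos y + u * sin x * sin y) + r\<^sup>2) powr (k + 1))))
         UNIV"
\<comment> \<open>At \<open>r = 0\<close> both sides are \<open>0\<close> because
  \<open>0 powr s = 0\<close>; the exponent is split by \<open>powr_realpow\<close> only for
  positive \<open>r\<close>.\<close>
proof (cases "r = 0")
  case True
  then show ?thesis by simp
next
  case False
  then have r: "r > 0" using assms by simp
  define f where "f n = complex_of_real (gamma_k k n * r powr (real_of_int \<bar>n\<bar> + k))
              * HO_E k n (\<i> * of_real x) * HO_E k n (- (\<i> * of_real y))" for n :: int
  define K where "K m x y = r powr k * (poisson_coeff k m x y * r ^ m)" for m x y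
  define T where "T = k / (2 * pi) * (1 - r\<^sup>2) * r powr k *
            integral {-1..1} (\<lambda>u. (1 + u) * (1 - u\<^sup>2) powr (k - 1) /
              (1 - 2 * r * (cos x * cos y + u * sin x * sin y) + r\<^sup>2) powr (k + 1))"
  have K_sums: "(\<lambda>m. K m x y) sums T"
    using sums_mult[OF sums_poisson_coeff[OF assms(1-3), of x y], of "r powr k"]
    unfolding K_def T_def by (simp add: mult_ac)
  have K_summable: "summable (\<lambda>n. K (Suc n) z z)" for z
    using summable_mult[OF sums_summable[OF sums_poisson_coeff[OF assms(1-3), of z z]], of "r powr k"]
    unfolding K_def by (subst summable_Suc_iff)
  have rp: "r powr (real_of_int \<bar>m\<bar> + k) = r powr k * r ^ Suc n" if "m = int (Suc n) \<or> m = - int (Suc n)" for m n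
  proof -
    have "real_of_int \<bar>m\<bar> = real (Suc n)" using that by auto
    then show ?thesis using r by (simp only: powr_add powr_realpow mult.commute)
  qed
  have bound: "norm (f m) \<le> (K (Suc n) x x + K (Suc n) y y) / 2" if m: "m = int (Suc n) \<or> m = - int (Suc n)" for m n
  proof -
    interpret ho_level k n by unfold_locales (rule assms)
    have "norm (f m) = r powr k * r ^ Suc n * (gamma_k k m * cmod (HO_E k m (\<i> * of_real x)) * cmod (HO_E k m (- (\<i> * of_real y))))"
      unfolding f_def rp[OF m] using gamma_nonneg[OF m] r by (simp add: norm_mult abs_mult norm_power)
    also have "\<dots> \<le> r powr k * r ^ Suc n * ((poisson_coeff k (Suc n) x x + poisson_coeff k (Suc n) y y) / 2)"
      using r by (intro mult_left_mono norm_kernel_term_le m) auto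
    also have "\<dots> = (K (Suc n) x x + K (Suc n) y y) / 2"
      by (simp add: K_def algebra_simps)
    finally show ?thesis .
  qed
  have summable_bound: "summable (\<lambda>n. (K (Suc n) x x + K (Suc n) y y) / 2)"
    by (intro summable_divide summable_add K_summable)
  have pair: "f (int (Suc n)) + f (- int (Suc n)) = of_real (K (Suc n) x y)" for n
  proof -
    interpret ho_level k n by unfold_locales (rule assms)
    have "f (int (Suc n)) + f (- int (Suc n)) = of_real (r powr k * r ^ Suc n) *
       (of_real (gamma_k k (int (Suc n))) * HO_E k (int (Suc n)) (\<i> * of_real x) * HO_E k (int (Suc n)) (- (\<i> * of_real y)) +
        of_real (gamma_k k (- int (Suc n))) * HO_E k (- int (Suc n)) (\<i> * of_real x) * HO_E k (- int (Suc n)) (- (\<i> * of_real y)))"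
      unfolding f_def rp[OF disjI1[OF refl]] rp[OF disjI2[OF refl]] of_real_mult
      by (simp only: distrib_left mult_ac)
    also have "\<dots> = of_real (K (Suc n) x y)"
      unfolding kernel kernel_poisson_coeff K_def by simp
    finally show ?thesis .
  qed
  have f0: "f 0 = of_real (K 0 x y)"
    using gamma_k_0[OF assms(1), of x y] by (simp add: f_def K_def HO_E_0)
  \<comment> \<open>The pairs start at \<open>m = 1\<close>; the unpaired index 0 is removed here
    and returns as \<open>f 0\<close>.\<close>
  have "(\<lambda>n. complex_of_real (K (Suc n) x y)) sums of_real (T - K 0 x y)"
    unfolding sums_of_real_iff using K_sums by (subst sums_Suc_iff) simp
  then have "(f has_sum (f 0 + of_real (T - K 0 x y))) UNIV"
    unfolding pair[symmetric]
    by (intro has_sum_int_pairing summable_comparison_test'[OF summable_bound]) (use bound in auto)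
  then have "(f has_sum of_real T) UNIV" by (simp add: f0)
  then show ?thesis unfolding f_def T_def .
qed

end
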